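(* Let $p$ be a monic polynomial of degree $n$ over $\mathbb{C}$. Let $K$ be any measurable subset of the plane $\mathbb{C}$. Then \[ \mathrm{Area}\left(p^{-1}(K)\right) \le \pi \left(\frac{\mathrm{Area}(K)}{\pi}\right)^{1/n}, \] with equality if and only if $K$ is (up to sets of measure zero) a disc and $p$ has a unique critical value at the center of that disc.
   Context: $\mathrm{Area}$ denotes two-dimensional Lebesgue measure on $\mathbb{C}$. A critical value of $p$ is a value $p(z_0)$ with $p'(z_0) = 0$.
   Formalization: The equality characterisation is stated for n ≥ 2 and 0 < Area(K) < ∞, since otherwise "only if" fails: p(z) = z gives equality for every K but has no critical value; a null K gives equality for every p; K = ℂ gives equality but is not a disc. Discs have positive radius. *)

theory Defs
  imports "HOL-Complex_Analysis.Complex_Analysis" "HOL-Computational_Algebra.Polynomial"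
begin

definition area :: "complex set \<Rightarrow> ennreal" where
  "area S = emeasure lebesgue S"

text \<open>Real powers on the extended nonnegative reals. Intended for positive exponents,
  where \<open>0\<close> is sent to \<open>0\<close> and \<open>\<infinity>\<close> to \<open>\<infinity>\<close>.\<close>

definition ennreal_powr :: "ennreal \<Rightarrow> real \<Rightarrow> ennreal" where
  "ennreal_powr x a = (if x = \<infinity> then \<infinity> else ennreal (enn2real x powr a))"

definition critical_values :: "complex poly \<Rightarrow> complex set" where
  "critical_values p = {poly p z | z. poly (pderiv p) z = 0}"

text \<open>Discs have positive radius. Whether the disc is taken open or closed is immaterial,
  as the boundary circle has measure zero.\<close>

definition ae_disc :: "complex set \<Rightarrow> complex \<Rightarrow> real \<Rightarrow> bool" where
  "ae_disc K c r \<longleftrightarrow> r > 0 \<and> sym_diff K (ball c r) \<in> null_sets lebesgue"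

text \<open>The next two lemmas show that preimages of Lebesgue measurable sets under a nonconstant
  polynomial are Lebesgue measurable. This matters because \<^const>\<open>emeasure\<close> is \<open>0\<close> by convention
  on non-measurable sets, so without it \<^term>\<open>area (poly p -` K)\<close> might not be the intended area.\<close>

lemma negligible_poly_vimage:
  fixes p :: "complex poly"
  assumes deg: "degree p \<ge> 1" and N: "negligible N"
  shows "negligible (poly p -` N)"
proof -
  let ?C = "{z. poly (pderiv p) z = 0}"
  have "pderiv p \<noteq> 0"
    using deg by (simp add: pderiv_eq_0_iff)
  then have "finite ?C"
    by (rule poly_roots_finite)
  then have negC: "negligible ?C"
    by (rule negligible_finite)
  have "negligible (poly p -` N - ?C)"
  proof (rule iffD2[OF locally_negligible_alt], rule ballI)
    fix x assume x: "x \<in> poly p -` N - ?C"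
    have hol: "poly p holomorphic_on S" for S
      by (intro holomorphic_intros)
    have "deriv (poly p) x = poly (pderiv p) x"
      by (intro DERIV_imp_deriv poly_DERIV)
    with x have "deriv (poly p) x \<noteq> 0"
      by simp
    then obtain r where r: "r > 0" and op: "open (poly p ` ball x r)" and inj: "inj_on (poly p) (ball x r)"
      using has_complex_derivative_locally_invertible[OF hol UNIV_I open_UNIV] by blast
    obtain g where g: "g holomorphic_on (poly p ` ball x r)"
        and gf: "\<And>z. z \<in> ball x r \<Longrightarrow> g (poly p z) = z"
      using holomorphic_has_inverse[OF hol open_ball inj] by metis
    let ?M = "N \<inter> poly p ` ball x r"
    let ?U = "(poly p -` N - ?C) \<inter> ball x r"
    have "g differentiable_on ?M"
      unfolding differentiable_on_def
    proof
      fix w assume "w \<in> ?M"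
      then have "g field_differentiable at w"
        using g op holomorphic_on_imp_differentiable_at by blast
      then show "g differentiable at w within ?M"
        by (meson differentiable_at_withinI field_differentiable_imp_differentiable)
    qed
    moreover have "negligible ?M"
      using N negligible_subset by blast
    ultimately have "negligible (g ` ?M)"
      using negligible_differentiable_image_negligible[of ?M g] by simp
    moreover have "?U \<subseteq> g ` ?M"
    proof
      fix z assume "z \<in> ?U"
      then have "poly p z \<in> ?M" "z = g (poly p z)"
        using gf by auto
      then show "z \<in> g ` ?M" by blast
    qed
    ultimately have "negligible ?U"
      using negligible_subset by blast
    moreover have "openin (top_of_set (poly p -` N - ?C)) ?U"
      by (rule openin_open_Int) simp
    moreover have "x \<in> ?U"
      using x r by simp
    ultimately show "\<exists>U. openin (top_of_set (poly p -` N - ?C)) U \<and> x \<in> U \<and> negligible U"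
      by blast
  qed
  from negligible_Un[OF this negC] show ?thesis
    by (rule negligible_subset) blast
qed

lemma sets_lebesgue_poly_vimage:
  fixes p :: "complex poly"
  assumes deg: "degree p \<ge> 1" and K: "K \<in> sets lebesgue"
  shows "poly p -` K \<in> sets lebesgue"
proof -
  obtain C T where C: "fsigma C" and T: "T \<in> null_sets lebesgue" and CT: "C \<union> T = K"
    using lebesgue_set_almost_fsigma[OF K] by metis
  have meas: "poly p \<in> borel_measurable borel"
    by (intro borel_measurable_continuous_onI continuous_intros)
  have "C \<in> sets borel"
    using C by cases auto
  then have "poly p -` C \<in> sets borel"
    using measurable_sets[OF meas, of C] by simp
  then have "poly p -` C \<in> sets lebesgue"
    by simp
  moreover have "poly p -` T \<in> sets lebesgue"
    using negligible_poly_vimage[OF deg] T negligible_iff_null_sets by blast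
  ultimately show ?thesis
    using CT by (metis sets.Un vimage_Un)
qed

end

theory Submission
  imports Defs "HOL-Real_Asymp.Real_Asymp" "HOL-Computational_Algebra.Fundamental_Theorem_Algebra"
begin

text \<open>
  Write \<open>E = p\<^sup>-\<^sup>1(K)\<close>. Since \<open>p\<close> is at most \<open>n\<close>-to-one, \<open>\<integral>\<^sub>E |p'|\<^sup>2 \<le> n Area(K)\<close>.
  On the other hand \<open>p'\<close> is \<open>n\<close> times a monic polynomial \<open>q\<close> of degree \<open>m = n - 1\<close>, and Polya's
  inequality \<open>Area{|q| \<le> t} \<le> \<pi> t\<^bsup>2/m\<^esup>\<close> limits how small \<open>|p'|\<close> can be on a set of given area: by the
  layer cake formula \<open>\<integral>\<^sub>E |p'|\<^sup>2 \<ge> n \<pi> (Area(E)/\<pi>)\<^sup>n\<close>. Comparing the two bounds gives the inequality.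

  Polya's inequality follows from the Ahlfors-Beurling bound \<open>|F| \<le> (\<pi> Area(E\<^sub>t))\<^bsup>1/2\<^esup>\<close> for the Cauchy
  transform \<open>F(z) = \<integral> 1/(\<zeta> - z)\<close> over \<open>E\<^sub>t = {|q| \<le> t}\<close>, and from the maximum principle for
  \<open>F\<^sup>m q\<close> outside \<open>E\<^sub>t\<close>, a function whose value at infinity is \<open>(- Area(E\<^sub>t))\<^sup>m\<close>.

  Equality forces equality in Polya's inequality for arbitrarily small \<open>t\<close>. If \<open>q\<close> had two distinct
  roots, the area of \<open>E\<^sub>t\<close> would be \<open>O(t\<^bsup>2/(m-1)\<^esup>)\<close>, which is too small; so \<open>q = (z - a)\<^sup>m\<close>, and
  the equality case of the layer cake comparison makes \<open>E\<close> a disc about \<open>a\<close>.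
\<close>

subsection \<open>The Ahlfors-Beurling bound\<close>

lemma emeasure_lborel_ball_complex:
  "r \<ge> 0 \<Longrightarrow> emeasure lborel (ball (c::complex) r) = ennreal (pi * r\<^sup>2)"
  by (simp add: emeasure_ball unit_ball_vol_2)

text \<open>Tonelli for the indicator of \<open>s < f x\<close>. Since \<open>ennreal\<close> sends
  negative reals to 0, only the positive part of \<open>f\<close> contributes, so \<open>f\<close>
  may change sign.\<close>

lemma nn_integral_layer_cake:
  fixes f :: "'a::euclidean_space \<Rightarrow> real"
  assumes [measurable]: "f \<in> borel_measurable borel" "E \<in> sets borel"
  shows "(\<integral>\<^sup>+x. ennreal (f x) * indicator E x \<partial>lborel) =
    (\<integral>\<^sup>+s. emeasure lborel {x\<in>E. s < f x} * indicator {0..} s \<partial>lborel)"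
proof -
  have "(\<integral>\<^sup>+x. ennreal (f x) * indicator E x \<partial>lborel) =
    (\<integral>\<^sup>+x. (\<integral>\<^sup>+s. indicator {x\<in>E. s < f x} x * indicator {0..} s \<partial>lborel) \<partial>lborel)"
  proof (intro nn_integral_cong)
    fix x
    have "(\<integral>\<^sup>+s. indicator {x\<in>E. s < f x} x * indicator {0..} s \<partial>lborel) =
      (\<integral>\<^sup>+s. indicator E x * indicator {0..<f x} s \<partial>lborel)"
      by (intro nn_integral_cong) (auto simp: indicator_def)
    also have "\<dots> = ennreal (f x) * indicator E x"
      by (cases "f x \<ge> 0") (auto simp: nn_integral_cmult mult.commute ennreal_neg)
    finally show "ennreal (f x) * indicator E x =
      (\<integral>\<^sup>+s. indicator {x\<in>E. s < f x} x * indicator {0..} s \<partial>lborel)" by simp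
  qed
  also have "\<dots> = (\<integral>\<^sup>+s. (\<integral>\<^sup>+x. indicator {x\<in>E. s < f x} x * indicator {0..} s \<partial>lborel) \<partial>lborel)"
    by (rule lborel_pair.Fubini'[symmetric]) measurable
  also have "\<dots> = (\<integral>\<^sup>+s. emeasure lborel {x\<in>E. s < f x} * indicator {0..} s \<partial>lborel)"
    by (intro nn_integral_cong) (simp add: nn_integral_multc)
  finally show ?thesis .
qed

text \<open>Inversion turns the half-plane of real part above \<open>s\<close> into a disc with
  \<open>z\<close> on its boundary. Clearing the denominator and completing the square makes this
  explicit.\<close>

lemma Re_divide_superlevel_eq_ball:
  assumes "cmod \<alpha> = 1" "s > 0"
  shows "{\<zeta>. s < Re (\<alpha> / (\<zeta> - z))} = ball (z + \<alpha> / of_real (2 * s)) (1 / (2 * s))"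
proof (intro set_eqI)
  fix \<zeta>
  define w where "w = \<zeta> - z"
  have a: "(Re \<alpha>)\<^sup>2 + (Im \<alpha>)\<^sup>2 = 1" using assms by (simp add: cmod_def)
  have "\<zeta> \<in> ball (z + \<alpha> / of_real (2 * s)) (1 / (2 * s)) \<longleftrightarrow> cmod (w - \<alpha> / of_real (2 * s)) < 1 / (2 * s)"
    by (simp add: w_def dist_norm norm_minus_commute algebra_simps)
  also have "\<dots> \<longleftrightarrow> (cmod (w - \<alpha> / of_real (2 * s)))\<^sup>2 < (1 / (2 * s))\<^sup>2"
    using assms power_mono_iff[of "1 / (2 * s)" "cmod (w - \<alpha> / of_real (2 * s))" 2] by (simp add: not_le[symmetric])
  also have "(cmod (w - \<alpha> / of_real (2 * s)))\<^sup>2 =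
    (Re w)\<^sup>2 + (Im w)\<^sup>2 - (Re w * Re \<alpha> + Im w * Im \<alpha>) / s + ((Re \<alpha>)\<^sup>2 + (Im \<alpha>)\<^sup>2) * (1 / (2 * s))\<^sup>2"
    unfolding cmod_power2 minus_complex.sel Re_divide_of_real Im_divide_of_real
    using assms by (simp add: power2_eq_square field_simps)
  also have "\<dots> < (1 / (2 * s))\<^sup>2 \<longleftrightarrow> s * ((Re w)\<^sup>2 + (Im w)\<^sup>2) < Re w * Re \<alpha> + Im w * Im \<alpha>"
    unfolding a by (simp only: mult_1 add_less_same_cancel2 diff_less_0_iff_less
        pos_less_divide_eq[OF assms(2)] mult.commute[of s])
  also have "\<dots> \<longleftrightarrow> s < Re (\<alpha> / w)"
  proof (cases "w = 0")
    \<comment> \<open>By convention \<open>\<alpha> / 0 = 0\<close>, so both sides are false, as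
      they should be: \<open>z\<close> lies on the boundary circle.\<close>
    case True
    then show ?thesis using assms by simp
  next
    case False
    then have "(Re w)\<^sup>2 + (Im w)\<^sup>2 > 0" by (simp add: complex_neq_0)
    then show ?thesis by (simp add: Re_divide field_simps)
  qed
  finally show "\<zeta> \<in> {\<zeta>. s < Re (\<alpha> / (\<zeta> - z))} \<longleftrightarrow> \<zeta> \<in> ball (z + \<alpha> / of_real (2 * s)) (1 / (2 * s))"
    by (simp add: w_def)
qed

text \<open>After a rotation the integral is real, and the layer cake formula reduces it to the
  areas of the superlevel sets of \<open>Re (\<alpha> / (\<zeta> - z))\<close> within
  \<open>E\<close>. At level \<open>s\<close> this area is at most \<open>A\<close> and, inside a
  disc of radius 1/(2s), at most pi/(4s^2). Using the better bound at each level gives the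
  constant.\<close>

lemma ahlfors_beurling:
  fixes E :: "complex set"
  assumes E: "compact E" and z: "z \<notin> E" and A: "measure lborel E = A" "A > 0"
  shows "cmod (LINT \<zeta>:E|lborel. 1 / (\<zeta> - z)) \<le> sqrt (pi * A)"
proof -
  define J where "J = (LINT \<zeta>:E|lborel. 1 / (\<zeta> - z))"
  \<comment> \<open>The two area bounds \<open>A\<close> and \<open>pi / (4 * s\<^sup>2)\<close>
    cross at \<open>s = c\<close>; the levels below and above \<open>c\<close> each contribute half
    of the final value.\<close>
  define c where "c = sqrt (pi / (4 * A))"
  have c: "c > 0" using A by (simp add: c_def)
  have Em[measurable]: "E \<in> sets borel" using E by (simp add: borel_compact)
  have emE: "emeasure lborel E = ennreal A"
    using A emeasure_compact_finite[OF E] by (simp add: emeasure_eq_ennreal_measure top.not_eq_extremum)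
  have int: "set_integrable lborel E (\<lambda>\<zeta>. 1 / (\<zeta> - z))"
    unfolding set_integrable_def
    by (intro borel_integrable_compact E continuous_intros) (use z in auto)
  show ?thesis
  proof (cases "J = 0")
    case True
    then show ?thesis using A by (simp add: J_def)
  next
    case False
    define \<alpha> where "\<alpha> = cnj (sgn J)"
    have \<alpha>: "cmod \<alpha> = 1" using False by (simp add: \<alpha>_def norm_sgn)
    let ?f = "\<lambda>\<zeta>. Re (\<alpha> / (\<zeta> - z))"
    have int\<alpha>: "set_integrable lborel E (\<lambda>\<zeta>. \<alpha> * (1 / (\<zeta> - z)))"
      using int by (rule set_integrable_mult_right)
    have fm[measurable]: "?f \<in> borel_measurable borel" by measurable
    have "\<alpha> * J = of_real (cmod J)"
      using False by (simp add: \<alpha>_def sgn_eq complex_norm_square[symmetric] power2_eq_square mult.commute)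
    then have "cmod J = Re (\<alpha> * J)" by simp
    also have "\<alpha> * J = (LINT \<zeta>:E|lborel. \<alpha> * (1 / (\<zeta> - z)))"
      unfolding J_def by (rule set_integral_mult_right[symmetric])
    also have "Re \<dots> = (LINT \<zeta>|lborel. indicator E \<zeta> * ?f \<zeta>)"
      using integral_Re[OF int\<alpha>[unfolded set_integrable_def]] by (simp add: set_lebesgue_integral_def)
    finally have J: "cmod J = (LINT \<zeta>|lborel. indicator E \<zeta> * ?f \<zeta>)" .
    have i1: "integrable lborel (\<lambda>\<zeta>. indicator E \<zeta> * ?f \<zeta>)"
      using integrable_Re[OF int\<alpha>[unfolded set_integrable_def]] by simp
    have i2: "integrable lborel (\<lambda>\<zeta>. max 0 (indicator E \<zeta> * ?f \<zeta>))"
      using i1 by (intro integrable_max) auto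
    have "ennreal (cmod J) \<le> ennreal (LINT \<zeta>|lborel. max 0 (indicator E \<zeta> * ?f \<zeta>))"
      unfolding J by (intro ennreal_leI integral_mono i1 i2) auto
    also have "\<dots> = (\<integral>\<^sup>+\<zeta>. ennreal (max 0 (indicator E \<zeta> * ?f \<zeta>)) \<partial>lborel)"
      by (rule nn_integral_eq_integral[symmetric, OF i2]) auto
    also have "\<dots> = (\<integral>\<^sup>+\<zeta>. ennreal (?f \<zeta>) * indicator E \<zeta> \<partial>lborel)"
      by (intro nn_integral_cong) (auto simp: indicator_def ennreal_neg max_def)
    also have "\<dots> = (\<integral>\<^sup>+s. emeasure lborel {\<zeta>\<in>E. s < ?f \<zeta>} * indicator {0..} s \<partial>lborel)"
      by (rule nn_integral_layer_cake) measurable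
    also have "\<dots> \<le> (\<integral>\<^sup>+s. ennreal A * indicator {0..c} s + ennreal (pi / (4 * s\<^sup>2)) * indicator {c..} s \<partial>lborel)"
    proof (intro nn_integral_mono)
      fix s :: real
      have b1: "emeasure lborel {\<zeta>\<in>E. s < ?f \<zeta>} \<le> ennreal A"
        unfolding emE[symmetric] by (intro emeasure_mono) auto
      have b2: "emeasure lborel {\<zeta>\<in>E. s < ?f \<zeta>} \<le> ennreal (pi / (4 * s\<^sup>2))" if "s > 0"
      proof -
        have "emeasure lborel {\<zeta>\<in>E. s < ?f \<zeta>} \<le> emeasure lborel (ball (z + \<alpha> / of_real (2 * s)) (1 / (2 * s)))"
          using Re_divide_superlevel_eq_ball[OF \<alpha> that, of z] by (intro emeasure_mono) (blast, simp)
        also have "\<dots> = ennreal (pi / (4 * s\<^sup>2))"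
          using that by (subst emeasure_lborel_ball_complex) (auto simp: power_divide power_mult_distrib)
        finally show ?thesis .
      qed
      show "emeasure lborel {\<zeta>\<in>E. s < ?f \<zeta>} * indicator {0..} s \<le>
          ennreal A * indicator {0..c} s + ennreal (pi / (4 * s\<^sup>2)) * indicator {c..} s"
      proof (cases "s < 0 \<or> s > c")
        case True
        then show ?thesis using b2 c by (auto simp: indicator_def)
      next
        case False
        then have "emeasure lborel {\<zeta>\<in>E. s < ?f \<zeta>} * indicator {0..} s \<le> ennreal A * indicator {0..c} s"
          using b1 by (auto simp: indicator_def)
        then show ?thesis by (rule order_trans) simp
      qed
    qed
    also have "\<dots> = ennreal A * ennreal c + (\<integral>\<^sup>+s. ennreal (pi / (4 * s\<^sup>2)) * indicator {c..} s \<partial>lborel)"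
      using c by (subst nn_integral_add) (auto simp: nn_integral_cmult)
    also have "(\<integral>\<^sup>+s. ennreal (pi / (4 * s\<^sup>2)) * indicator {c..} s \<partial>lborel) = ennreal (0 - (- pi / (4 * c)))"
    proof (rule nn_integral_FTC_atLeast)
      show "((\<lambda>s. - pi / (4 * s)) \<longlongrightarrow> 0) at_top" by real_asymp
      fix s assume "c \<le> s"
      then have "s > 0" using c by simp
      then show "((\<lambda>s. - pi / (4 * s)) has_real_derivative pi / (4 * s\<^sup>2)) (at s)"
        by (auto intro!: derivative_eq_intros simp: power2_eq_square field_simps)
    qed auto
    also have "ennreal A * ennreal c + ennreal (0 - (- pi / (4 * c))) = ennreal (A * c + pi / (4 * c))"
      using c A by (simp add: ennreal_mult ennreal_plus)
    also have "A * c + pi / (4 * c) = sqrt (pi * A)"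
    proof -
      have cc: "c * c = pi / (4 * A)" using A by (simp add: c_def)
      have "A * c + pi / (4 * c) = (A * (c * c) + pi / 4) / c" using c by (simp add: field_simps)
      also have "\<dots> = (pi / 2) / c" unfolding cc using A by (simp add: field_simps)
      also have "\<dots> = sqrt (pi * A)"
      proof -
        have "(sqrt (pi * A) * c) = sqrt (pi * A * (pi / (4 * A)))" by (simp only: c_def real_sqrt_mult[symmetric])
        also have "pi * A * (pi / (4 * A)) = (pi / 2)\<^sup>2" using A by (simp add: power2_eq_square field_simps)
        also have "sqrt ((pi / 2)\<^sup>2) = pi / 2" by (subst real_sqrt_abs) simp
        finally show ?thesis using c by (simp only: divide_eq_eq) simp
      qed
      finally show ?thesis .
    qed
    finally have "ennreal (cmod J) \<le> ennreal (sqrt (pi * A))" .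
    then show ?thesis using A by (simp add: J_def)
  qed
qed

section \<open>The Cauchy transform: holomorphy and behaviour at infinity\<close>

definition cauchy_transform :: "complex set \<Rightarrow> complex \<Rightarrow> complex" where
  "cauchy_transform E z = (LINT \<zeta>:E|lborel. 1 / (\<zeta> - z))"

lemma set_integrable_continuous_compact:
  fixes f :: "'a::euclidean_space \<Rightarrow> 'b::{banach, second_countable_topology}"
  shows "compact E \<Longrightarrow> continuous_on E f \<Longrightarrow> set_integrable lborel E f"
  unfolding set_integrable_def by (rule borel_integrable_compact)

lemma norm_set_integral_le:
  fixes f :: "complex \<Rightarrow> complex"
  assumes E: "compact E" and f: "continuous_on E f" and B: "\<And>\<zeta>. \<zeta> \<in> E \<Longrightarrow> cmod (f \<zeta>) \<le> B"
  shows "cmod (LINT \<zeta>:E|lborel. f \<zeta>) \<le> B * measure lborel E"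
proof -
  have "cmod (LINT \<zeta>:E|lborel. f \<zeta>) \<le> (LINT \<zeta>:E|lborel. cmod (f \<zeta>))"
    by (intro set_integral_norm_bound set_integrable_continuous_compact E f)
  also have "\<dots> \<le> (LINT \<zeta>:E|lborel. B)"
    by (intro set_integral_mono set_integrable_continuous_compact E continuous_intros f B) auto
  also have "\<dots> = B * measure lborel E"
    using emeasure_compact_finite[OF E] E by (simp add: set_integral_const borel_compact top.not_eq_extremum)
  finally show ?thesis .
qed

text \<open>Differentiation under the integral suggests the derivative. The error of the difference
  quotient is the integral of \<open>h / ((\<zeta> - (z + h)) * (\<zeta> - z)\<^sup>2)\<close>,
  which is O(h) because \<open>z\<close> has positive distance from \<open>E\<close>.\<close>

lemma cauchy_transform_holomorphic:
  assumes E: "compact E"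
  shows "cauchy_transform E holomorphic_on - E"
proof -
  let ?F = "cauchy_transform E"
  have op: "open (- E)" using E by (simp add: compact_imp_closed open_Compl)
  have "\<exists>D. (?F has_field_derivative D) (at z)" if z: "z \<in> - E" for z
  proof -
    obtain d where d: "d > 0" "ball z d \<subseteq> - E"
      using op z by (meson openE)
    have far: "cmod (\<zeta> - z) \<ge> d" if "\<zeta> \<in> E" for \<zeta>
    proof -
      have "\<zeta> \<notin> ball z d" using d(2) that by blast
      then show ?thesis by (simp add: dist_norm norm_minus_commute)
    qed
    let ?D = "LINT \<zeta>:E|lborel. 1 / (\<zeta> - z)\<^sup>2"
    \<comment> \<open>On \<open>E\<close> the two distances are at least \<open>d\<close> (from
      \<open>z\<close>) and \<open>d / 2\<close> (from \<open>z + h\<close>), so the integrand is at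
      most 2|h|/d^3.\<close>
    let ?C = "2 * measure lborel E / d ^ 3"
    have bound: "cmod ((?F (z + h) - ?F z) / h - ?D) \<le> cmod h * ?C" if h: "h \<noteq> 0" "cmod h < d / 2" for h
    proof -
      have far': "cmod (\<zeta> - (z + h)) \<ge> d / 2" if "\<zeta> \<in> E" for \<zeta>
      proof -
        have "cmod (\<zeta> - z) \<le> cmod (\<zeta> - (z + h)) + cmod h"
          using norm_triangle_ineq[of "\<zeta> - (z + h)" h] by simp
        then show ?thesis using far[OF that] h by linarith
      qed
      have nz: "\<zeta> - z \<noteq> 0" "\<zeta> - (z + h) \<noteq> 0" if "\<zeta> \<in> E" for \<zeta>
        using far[OF that] far'[OF that] d(1) by auto
      have i1: "set_integrable lborel E (\<lambda>\<zeta>. 1 / (\<zeta> - (z + h)))"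
        and i2: "set_integrable lborel E (\<lambda>\<zeta>. 1 / (\<zeta> - z))"
        and i3: "set_integrable lborel E (\<lambda>\<zeta>. 1 / (\<zeta> - z)\<^sup>2)"
        using nz by (auto intro!: set_integrable_continuous_compact E continuous_intros)
      have i4: "set_integrable lborel E (\<lambda>\<zeta>. (1 / (\<zeta> - (z + h)) - 1 / (\<zeta> - z)) / h)"
        by (intro set_integrable_divide set_integral_diff i1 i2)
      have "(?F (z + h) - ?F z) / h - ?D
          = (LINT \<zeta>:E|lborel. (1 / (\<zeta> - (z + h)) - 1 / (\<zeta> - z)) / h - 1 / (\<zeta> - z)\<^sup>2)"
        unfolding cauchy_transform_def
        by (simp add: set_integral_diff[OF i1 i2] set_integral_diff[OF i4 i3])
      also have "\<dots> = (LINT \<zeta>:E|lborel. h / ((\<zeta> - (z + h)) * (\<zeta> - z)\<^sup>2))"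
      proof (intro set_lebesgue_integral_cong ballI allI impI)
        show "E \<in> sets lborel" using E by (simp add: borel_compact)
        fix \<zeta> assume "\<zeta> \<in> E"
        note nz = nz[OF this]
        define a where "a = \<zeta> - z"
        have "a \<noteq> 0" "a - h \<noteq> 0" using nz by (auto simp: a_def algebra_simps)
        then have "(1 / (a - h) - 1 / a) / h - 1 / a\<^sup>2 = h / ((a - h) * a\<^sup>2)"
          using h(1) by (simp add: divide_simps) (simp add: algebra_simps power2_eq_square)
        then show "(1 / (\<zeta> - (z + h)) - 1 / (\<zeta> - z)) / h - 1 / (\<zeta> - z)\<^sup>2 = h / ((\<zeta> - (z + h)) * (\<zeta> - z)\<^sup>2)"
          by (simp add: a_def diff_diff_eq)
      qed
      also have "cmod \<dots> \<le> (cmod h / (d / 2 * d\<^sup>2)) * measure lborel E"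
      proof (intro norm_set_integral_le E)
        show "continuous_on E (\<lambda>\<zeta>. h / ((\<zeta> - (z + h)) * (\<zeta> - z)\<^sup>2))"
          using nz by (intro continuous_intros) auto
        fix \<zeta> assume "\<zeta> \<in> E"
        then show "cmod (h / ((\<zeta> - (z + h)) * (\<zeta> - z)\<^sup>2)) \<le> cmod h / (d / 2 * d\<^sup>2)"
          unfolding norm_divide norm_mult norm_power using d(1) far far'
          by (intro divide_left_mono mult_mono power_mono mult_pos_pos zero_less_power) (auto dest: nz)
      qed
      also have "d / 2 * d\<^sup>2 = d ^ 3 / 2" by (simp add: power2_eq_square power3_eq_cube)
      also have "cmod h / (d ^ 3 / 2) * measure lborel E = cmod h * ?C" by simp
      finally show ?thesis .
    qed
    have "((\<lambda>h. (?F (z + h) - ?F z) / h - ?D) \<longlongrightarrow> 0) (at 0)"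
    proof (rule Lim_null_comparison)
      show "\<forall>\<^sub>F h in at 0. cmod ((?F (z + h) - ?F z) / h - ?D) \<le> cmod h * ?C"
        unfolding eventually_at using bound d(1) by (intro exI[of _ "d / 2"]) auto
      show "((\<lambda>h. cmod h * ?C) \<longlongrightarrow> 0) (at 0)"
        using d(1) by (auto intro!: tendsto_eq_intros)
    qed
    then have "(?F has_field_derivative ?D) (at z)"
      unfolding DERIV_def using LIM_zero_iff by blast
    then show ?thesis by blast
  qed
  then show ?thesis
    using op by (auto simp: holomorphic_on_open)
qed

text \<open>Since z/(zeta - z) + 1 = zeta/(zeta - z) and \<open>E\<close> is bounded, the error is
  the integral over \<open>E\<close> of a quantity of size O(1/|z|).\<close>

lemma cauchy_transform_at_infinity:
  assumes E: "compact E"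
  shows "((\<lambda>z. z * cauchy_transform E z) \<longlongrightarrow> - of_real (measure lborel E)) at_infinity"
proof -
  let ?A = "measure lborel E"
  obtain R where R: "R > 0" "\<And>\<zeta>. \<zeta> \<in> E \<Longrightarrow> cmod \<zeta> \<le> R"
    using compact_imp_bounded[OF E] by (metis bounded_pos)
  have "((\<lambda>z. z * cauchy_transform E z + of_real ?A) \<longlongrightarrow> 0) at_infinity"
  proof (rule Lim_null_comparison)
    show "\<forall>\<^sub>F z in at_infinity. cmod (z * cauchy_transform E z + of_real ?A) \<le> R / (cmod z - R) * ?A"
    \<comment> \<open>From this radius on, \<open>z\<close> is outside \<open>E\<close> and
      \<open>cmod z - R\<close> is positive.\<close>
    proof (rule eventually_at_infinityI[of "2 * R"])
      fix z :: complex assume z: "2 * R \<le> cmod z"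
      have nz: "\<zeta> - z \<noteq> 0" and far: "cmod (\<zeta> - z) \<ge> cmod z - R" if "\<zeta> \<in> E" for \<zeta>
      proof -
        show "cmod (\<zeta> - z) \<ge> cmod z - R"
          using R(2)[OF that] norm_triangle_ineq3[of \<zeta> z] by linarith
        show "\<zeta> - z \<noteq> 0" using R(2)[OF that] R(1) z by auto
      qed
      have i1: "set_integrable lborel E (\<lambda>\<zeta>. z * (1 / (\<zeta> - z)))"
        and i2: "set_integrable lborel E (\<lambda>\<zeta>. 1 :: complex)"
        using nz by (auto intro!: set_integrable_continuous_compact E continuous_intros)
      have "z * cauchy_transform E z + of_real ?A =
        (LINT \<zeta>:E|lborel. z * (1 / (\<zeta> - z))) + (LINT \<zeta>:E|lborel. 1)"
        using emeasure_compact_finite[OF E] E unfolding cauchy_transform_def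
        by (simp only: set_integral_mult_right)
          (simp add: set_integral_const borel_compact top.not_eq_extremum scaleR_conv_of_real)
      also have "\<dots> = (LINT \<zeta>:E|lborel. z * (1 / (\<zeta> - z)) + 1)"
        by (rule set_integral_add(2)[OF i1 i2, symmetric])
      also have "\<dots> = (LINT \<zeta>:E|lborel. \<zeta> / (\<zeta> - z))"
      proof (intro set_lebesgue_integral_cong ballI allI impI)
        show "E \<in> sets lborel" using E by (simp add: borel_compact)
        fix \<zeta> assume "\<zeta> \<in> E"
        then show "z * (1 / (\<zeta> - z)) + 1 = \<zeta> / (\<zeta> - z)" using nz by (simp add: divide_simps)
      qed
      also have "cmod \<dots> \<le> R / (cmod z - R) * ?A"
      proof (intro norm_set_integral_le E)
        show "continuous_on E (\<lambda>\<zeta>. \<zeta> / (\<zeta> - z))"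
          using nz by (intro continuous_intros) auto
        fix \<zeta> assume \<zeta>: "\<zeta> \<in> E"
        show "cmod (\<zeta> / (\<zeta> - z)) \<le> R / (cmod z - R)"
          unfolding norm_divide using R(1) z by (intro frac_le R far \<zeta>) auto
      qed
      finally show "cmod (z * cauchy_transform E z + of_real ?A) \<le> R / (cmod z - R) * ?A" .
    qed
    have "filterlim (\<lambda>z::complex. cmod z - R) at_top at_infinity"
      using filterlim_tendsto_add_at_top[OF tendsto_const filterlim_norm_at_top, of "- R"]
      by (simp add: add.commute)
    then show "((\<lambda>z. R / (cmod z - R) * ?A) \<longlongrightarrow> 0) at_infinity"
      by (intro tendsto_mult_left_zero tendsto_divide_0[OF tendsto_const] filterlim_at_top_imp_at_infinity)
  qed
  then show ?thesis
    using Lim_null[of "\<lambda>z. z * cauchy_transform E z"] by simp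
qed

subsection \<open>Polya's inequality\<close>

lemma compact_poly_sublevel:
  fixes q :: "complex poly"
  assumes "degree q \<ge> 1"
  shows "compact {z. cmod (poly q z) \<le> t}"
proof -
  have "closed {z. cmod (poly q z) \<le> t}"
    by (intro closed_Collect_le continuous_intros)
  moreover have inf: "filterlim (poly q) at_infinity at_infinity"
    using assms by (intro filterlim_poly_at_infinity) simp
  have "\<forall>\<^sub>F z in at_infinity. t + 1 \<le> cmod (poly q z)"
    using filterlim_compose[OF filterlim_norm_at_top inf] by (simp add: filterlim_at_top)
  then obtain b where "\<And>z. b \<le> cmod z \<Longrightarrow> t + 1 \<le> cmod (poly q z)"
    unfolding eventually_at_infinity by blast
  then have "cmod z \<le> b" if "cmod (poly q z) \<le> t" for z
    using that by (smt (verit))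
  then have "bounded {z. cmod (poly q z) \<le> t}"
    by (auto intro: boundedI)
  ultimately show ?thesis by (simp add: compact_eq_bounded_closed)
qed

text \<open>Maximum principle for \<open>F ^ m * q\<close> on the region |q| > s, where the
  Ahlfors-Beurling bound controls the boundary values. Taking \<open>s\<close> strictly above
  \<open>t\<close> keeps the closure of this region off \<open>E\<close>, so that \<open>F\<close>
  is holomorphic in a neighbourhood of it.\<close>

lemma cauchy_transform_power_mult_poly_le:
  fixes q :: "complex poly"
  assumes deg: "degree q = m" "m \<ge> 1" and lead: "lead_coeff q = 1" and t: "0 \<le> t" "t < s"
    and E: "E = {z. cmod (poly q z) \<le> t}" and A: "measure lborel E = A" "A > 0"
    and z0: "cmod (poly q z0) > s"
  shows "cmod (cauchy_transform E z0) ^ m * cmod (poly q z0) \<le> sqrt (pi * A) ^ m * s"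
proof -
  let ?F = "cauchy_transform E"
  let ?G = "\<lambda>z. ?F z ^ m * poly q z"
  define M where "M = sqrt (pi * A) ^ m"
  have cE: "compact E" unfolding E using deg by (intro compact_poly_sublevel) simp
  have M: "M > 0" using A by (simp add: M_def)
  have s: "s > 0" using t by simp
  have FM: "cmod (?F z) ^ m \<le> M" if "z \<notin> E" for z
    unfolding M_def using ahlfors_beurling[OF cE that A] 
    by (intro power_mono) (simp_all add: cauchy_transform_def)
  have inf: "filterlim (poly q) at_infinity at_infinity"
    using deg by (intro filterlim_poly_at_infinity) simp
  have Glim: "(?G \<longlongrightarrow> (- of_real A) ^ m) at_infinity"
  proof -
    have "((\<lambda>z. (z * ?F z) ^ m * (poly q z / z ^ m)) \<longlongrightarrow> (- of_real A) ^ m * 1) at_infinity"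
      using cauchy_transform_at_infinity[OF cE] poly_divide_tendsto_aux[of q] A deg lead
      by (intro tendsto_mult tendsto_power) auto
    moreover have "\<forall>\<^sub>F z in at_infinity. (z * ?F z) ^ m * (poly q z / z ^ m) = ?G z"
      by (rule eventually_at_infinityI[of 1]) (auto simp: power_mult_distrib)
    ultimately show ?thesis by (simp add: tendsto_cong)
  qed
  \<comment> \<open>Dividing by \<open>q\<close> makes \<open>G\<^sup>N / q\<close> vanish at infinity, so the maximum principle on bounded pieces of
    the exterior suffices; letting \<open>N\<close> tend to infinity then removes the factor.\<close>
  have key: "cmod (?G z0) ^ N \<le> (cmod (poly q z0) / s) * (M * s) ^ N" for N
  proof -
    let ?H = "\<lambda>z. ?G z ^ N / poly q z"
    let ?B = "(M * s) ^ N / s"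
    have "(?H \<longlongrightarrow> 0) at_infinity"
      using tendsto_divide_0[OF tendsto_power[OF Glim] inf] .
    then have "\<forall>\<^sub>F z in at_infinity. dist (?H z) 0 < ?B"
      by (rule tendstoD) (use M s in auto)
    then obtain R0 where R0: "\<And>z. R0 \<le> cmod z \<Longrightarrow> cmod (?H z) < ?B"
      unfolding eventually_at_infinity by auto
    \<comment> \<open>The circle of radius \<open>R\<close> lies where \<open>cmod (?H z)\<close> is
      already below \<open>?B\<close>, and \<open>z0\<close> lies inside it.\<close>
    define R where "R = max R0 (cmod z0 + 1)"
    define S where "S = {z. s < cmod (poly q z) \<and> cmod z < R}"
    have Seq: "S = {z. s < cmod (poly q z)} \<inter> ball 0 R" by (auto simp: S_def)
    have opS: "open S" unfolding Seq by (intro open_Int open_Collect_less continuous_intros open_ball)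
    have "closed {z. s \<le> cmod (poly q z) \<and> cmod z \<le> R}"
      by (intro closed_Collect_conj closed_Collect_le continuous_intros)
    then have clS: "closure S \<subseteq> {z. s \<le> cmod (poly q z) \<and> cmod z \<le> R}"
      by (intro closure_minimal) (auto simp: S_def)
    have sub: "closure S \<subseteq> - E - {z. poly q z = 0}"
      using clS t by (auto simp: E)
    have holH: "?H holomorphic_on - E - {z. poly q z = 0}"
      by (intro holomorphic_intros holomorphic_on_subset[OF cauchy_transform_holomorphic[OF cE]]) auto
    have "cmod (?H z0) \<le> ?B"
    proof (rule maximum_modulus_frontier[where S = S and f = ?H and \<xi> = z0])
      show "?H holomorphic_on interior S"
        using holH sub closure_subset[of S] interior_subset[of S] by (meson holomorphic_on_subset order_trans)
      show "continuous_on (closure S) ?H"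
        using holH sub holomorphic_on_imp_continuous_on holomorphic_on_subset by blast
      show "bounded S" unfolding Seq by (simp add: bounded_Int)
      show "z0 \<in> S" using z0 by (simp add: S_def R_def)
      fix z assume "z \<in> frontier S"
      then have z: "z \<in> closure S" "z \<notin> S" using opS by (auto simp: frontier_def interior_open)
      then have zs: "s \<le> cmod (poly q z)" "cmod z \<le> R" using clS by auto
      show "cmod (?H z) \<le> ?B"
      proof (cases "cmod z = R")
        case True
        then show ?thesis using R0[of z] by (simp add: R_def)
      next
        case False
        \<comment> \<open>A frontier point off the circle is not in the open set \<open>S\<close>
          but is in its closure, so |q| equals \<open>s\<close> there.\<close>
        then have qz: "cmod (poly q z) = s" using z(2) zs by (auto simp: S_def)
        have "z \<notin> E" using sub z(1) by auto
        then have "(cmod (?F z) ^ m * s) ^ N \<le> (M * s) ^ N"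
          using FM s by (intro power_mono mult_right_mono) auto
        then show ?thesis
          using s by (simp add: norm_divide norm_mult norm_power qz divide_right_mono)
      qed
    qed
    then have "cmod (?G z0) ^ N / cmod (poly q z0) \<le> ?B"
      by (simp only: norm_divide norm_power)
    moreover have "cmod (poly q z0) > 0" using z0 s by linarith
    ultimately show ?thesis using s by (simp only: pos_divide_le_eq) (simp add: field_simps)
  qed
  have "cmod (?G z0) \<le> M * s"
  proof (rule ccontr)
    assume "\<not> cmod (?G z0) \<le> M * s"
    \<comment> \<open>Powers of a ratio above 1 eventually exceed the factor
      \<open>cmod (poly q z0) / s\<close> in \<open>key\<close>, which does not depend on
      \<open>N\<close>.\<close>
    then have gt: "1 < cmod (?G z0) / (M * s)" using M s by (simp add: field_simps)
    obtain N where "cmod (poly q z0) / s < (cmod (?G z0) / (M * s)) ^ N"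
      using real_arch_pow[OF gt] by blast
    then have "cmod (poly q z0) / s * (M * s) ^ N < cmod (?G z0) ^ N"
      using M s by (simp only: power_divide pos_less_divide_eq zero_less_power mult_pos_pos)
    then show False using key[of N] by linarith
  qed
  then show ?thesis by (simp add: M_def norm_mult norm_power)
qed

text \<open>Letting \<open>z\<close> tend to infinity in the bound on \<open>F ^ m * q\<close> gives
  \<open>A ^ m \<le> sqrt (pi * A) ^ m * s\<close> for every \<open>s > t\<close>, hence for
  \<open>t\<close> itself. Squaring removes the root and one factor \<open>A ^ m\<close>
  cancels.\<close>

theorem polya_area_power:
  fixes q :: "complex poly"
  assumes deg: "degree q = m" "m \<ge> 1" and lead: "lead_coeff q = 1" and t: "0 \<le> t"
  shows "measure lborel {z. cmod (poly q z) \<le> t} ^ m \<le> pi ^ m * t\<^sup>2"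
proof -
  define E where "E = {z. cmod (poly q z) \<le> t}"
  define A where "A = measure lborel E"
  have cE: "compact E" unfolding E_def using deg by (intro compact_poly_sublevel) simp
  show ?thesis
  proof (cases "A = 0")
    case True
    then show ?thesis using deg by (simp add: A_def E_def power_0_left)
  next
    case False
    then have A: "A > 0" by (simp add: A_def zero_less_measure_iff)
    have inf: "filterlim (poly q) at_infinity at_infinity"
      using deg by (intro filterlim_poly_at_infinity) simp
    have Glim: "((\<lambda>z. cmod (cauchy_transform E z) ^ m * cmod (poly q z)) \<longlongrightarrow> A ^ m) at_infinity"
    proof -
      have "((\<lambda>z. cmod ((z * cauchy_transform E z) ^ m * (poly q z / z ^ m))) \<longlongrightarrow> cmod ((- of_real A) ^ m * 1)) at_infinity"
        using cauchy_transform_at_infinity[OF cE] poly_divide_tendsto_aux[of q] deg lead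
        by (intro tendsto_norm tendsto_mult tendsto_power) (auto simp: A_def)
      moreover have "\<forall>\<^sub>F z in at_infinity. cmod ((z * cauchy_transform E z) ^ m * (poly q z / z ^ m)) =
          cmod (cauchy_transform E z) ^ m * cmod (poly q z)"
        by (rule eventually_at_infinityI[of 1]) (auto simp: power_mult_distrib norm_mult norm_power norm_divide)
      ultimately have "((\<lambda>z. cmod (cauchy_transform E z) ^ m * cmod (poly q z)) \<longlongrightarrow> cmod ((- of_real A) ^ m * 1)) at_infinity"
        by (rule Lim_transform_eventually)
      then show ?thesis using A by (simp add: norm_power)
    qed
    have "A ^ m \<le> sqrt (pi * A) ^ m * s" if "s > t" for s
    proof (rule tendsto_upperbound[OF Glim])
      have "\<forall>\<^sub>F z in at_infinity. s + 1 \<le> cmod (poly q z)"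
        using filterlim_compose[OF filterlim_norm_at_top inf] by (simp add: filterlim_at_top)
      then show "\<forall>\<^sub>F z in at_infinity. cmod (cauchy_transform E z) ^ m * cmod (poly q z) \<le> sqrt (pi * A) ^ m * s"
      proof (rule eventually_mono)
        fix z assume "s + 1 \<le> cmod (poly q z)"
        then show "cmod (cauchy_transform E z) ^ m * cmod (poly q z) \<le> sqrt (pi * A) ^ m * s"
          by (intro cauchy_transform_power_mult_poly_le[OF deg lead t that E_def A_def[symmetric] A]) simp
      qed
    qed (rule trivial_limit_at_infinity)
    then have "A ^ m / sqrt (pi * A) ^ m \<le> s" if "s > t" for s
      using that A by (simp add: pos_divide_le_eq mult.commute)
    then have "A ^ m / sqrt (pi * A) ^ m \<le> t" by (rule dense_ge)
    then have "A ^ m \<le> t * sqrt (pi * A) ^ m" using A by (simp add: pos_divide_le_eq)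
    then have "(A ^ m)\<^sup>2 \<le> (t * sqrt (pi * A) ^ m)\<^sup>2" using A by (intro power_mono) auto
    also have "\<dots> = t\<^sup>2 * (sqrt (pi * A))\<^sup>2 ^ m" by (simp add: power_mult_distrib power_mult[symmetric] mult.commute)
    also have "\<dots> = t\<^sup>2 * pi ^ m * A ^ m" using A by (simp add: power_mult_distrib)
    finally have "A ^ m * A ^ m \<le> (t\<^sup>2 * pi ^ m) * A ^ m" by (simp add: power2_eq_square)
    then have "A ^ m \<le> t\<^sup>2 * pi ^ m" using A by simp
    then show ?thesis by (simp add: A_def E_def mult.commute)
  qed
qed

section \<open>Polynomials determined by a single root or critical value\<close>

lemma poly_eq_power_if_unique_root:
  fixes q :: "complex poly"
  assumes "{z. poly q z = 0} = {a}"
  shows "q = smult (lead_coeff q) ([:-a, 1:] ^ degree q)"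
proof -
  have q: "q = smult (lead_coeff q) ([:-a, 1:] ^ order a q)"
    using complex_poly_decompose[of q] unfolding assms by simp
  have "q \<noteq> 0"
  proof
    assume "q = 0"
    then have "UNIV = {a}" using assms by simp
    then show False using infinite_UNIV_char_0[where 'a = complex] by (metis finite.emptyI finite_insert)
  qed
  then have "degree q = order a q"
    using arg_cong[OF q, of degree] by (simp add: degree_power_eq)
  then show ?thesis using q by metis
qed

lemma monic_poly_eq_of_pderiv_eq:
  fixes p :: "complex poly"
  assumes n: "n \<ge> 1" and "pderiv p = smult (of_nat n) ([:-a, 1:] ^ (n - 1))"
  shows "poly p z = (z - a) ^ n + poly p a"
proof -
  obtain k where k: "n = Suc k" using n by (cases n) auto
  have "pderiv (p - [:-a, 1:] ^ n) = 0"
    using assms unfolding k by (simp add: pderiv_diff pderiv_power_Suc pderiv_pCons del: power_Suc)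
  then have "degree (p - [:-a, 1:] ^ n) = 0" by (simp add: pderiv_eq_0_iff)
  then obtain c where "p - [:-a, 1:] ^ n = [:c:]" by (rule degree_eq_zeroE)
  then have "p = [:-a, 1:] ^ n + [:c:]" by (simp add: algebra_simps)
  then have *: "poly p z = (z - a) ^ n + c" for z by simp
  show ?thesis using n by (simp add: * power_0_left)
qed

text \<open>Every critical point is a root of \<open>p - [:c:]\<close>, with order one higher than
  in \<open>pderiv p\<close>. The orders in \<open>pderiv p\<close> add up to \<open>n - 1\<close>,
  so those in \<open>p - [:c:]\<close> add up to \<open>n - 1\<close> plus the number of critical
  points. As the total is at most \<open>n\<close>, there is only one critical point.\<close>

lemma unique_critical_value_imp_power:
  fixes p :: "complex poly"
  assumes lead: "lead_coeff p = 1" and n: "degree p = n" "n \<ge> 2"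
    and crit: "{poly p z | z. poly (pderiv p) z = 0} = {c}"
  obtains a where "\<And>z. poly p z = (z - a) ^ n + c"
proof -
  let ?P = "p - [:c:]" and ?R = "{z. poly (pderiv p) z = 0}"
  have dP: "degree ?P = n" unfolding diff_conv_add_uminus using n by (subst degree_add_eq_left) auto
  have P0: "?P \<noteq> 0" using dP n by auto
  have p'0: "pderiv p \<noteq> 0" using n by (simp add: pderiv_eq_0_iff)
  have dp': "degree (pderiv p) = n - 1" using n by (simp add: degree_pderiv)
  have pd: "pderiv ?P = pderiv p" by (simp add: pderiv_diff)
  have finR: "finite ?R" using p'0 by (rule poly_roots_finite)
  have rootP: "poly ?P z = 0" if "z \<in> ?R" for z using crit that by auto
  have ord: "order z ?P = Suc (order z (pderiv p))" if "z \<in> ?R" for z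
    using order_pderiv[OF P0 rootP[OF that]] by (simp only: pd)
  have "(\<Sum>z\<in>?R. order z (pderiv p)) = n - 1"
  proof -
    have "degree (\<Prod>z\<in>?R. [:-z, 1:] ^ order z (pderiv p)) = (\<Sum>z\<in>?R. order z (pderiv p))"
      by (subst degree_prod_eq_sum_degree) (auto simp: degree_power_eq)
    moreover have "degree (smult (lead_coeff (pderiv p)) (\<Prod>z\<in>?R. [:-z, 1:] ^ order z (pderiv p))) = n - 1"
      using complex_poly_decompose[of "pderiv p"] dp' by simp
    ultimately show ?thesis using p'0 by simp
  qed
  moreover have "(\<Sum>z\<in>?R. order z ?P) = (\<Sum>z\<in>?R. order z (pderiv p)) + card ?R"
    using ord by (simp add: sum_Suc)
  moreover have "(\<Sum>z\<in>?R. order z ?P) \<le> (\<Sum>z | poly ?P z = 0. order z ?P)"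
    using rootP poly_roots_finite[OF P0] by (intro sum_mono2) auto
  moreover have "\<dots> \<le> n" using sum_order_le_degree[OF P0] dP by simp
  ultimately have "card ?R \<le> 1" using n by linarith
  moreover have "?R \<noteq> {}" using crit by auto
  ultimately have "card ?R = 1" using finR by (simp add: card_gt_0_iff le_antisym Suc_leI)
  then obtain a where a: "?R = {a}" by (rule card_1_singletonE)
  have "pderiv p = smult (of_nat n) ([:-a, 1:] ^ (n - 1))"
  proof -
    have "lead_coeff (pderiv p) = of_nat n"
      using n lead by (simp add: dp' coeff_pderiv)
    then show ?thesis using poly_eq_power_if_unique_root[OF a] dp' by metis
  qed
  then have "poly p z = (z - a) ^ n + poly p a" for z
    using n by (intro monic_poly_eq_of_pderiv_eq) auto
  moreover have "poly p a = c" using crit a by auto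
  ultimately show ?thesis using that by simp
qed

section \<open>Areas of sublevel sets and the extremal polynomials\<close>

text \<open>The square stays inside the power because the level is later \<open>sqrt s / n\<close>,
  whose square is linear in \<open>s\<close>.\<close>

corollary polya_area:
  fixes q :: "complex poly"
  assumes deg: "degree q = m" "m \<ge> 1" and lead: "lead_coeff q = 1" and t: "0 \<le> t"
  shows "emeasure lborel {z. cmod (poly q z) \<le> t} \<le> ennreal (pi * (t\<^sup>2) powr (1 / real m))"
proof -
  define A where "A = measure lborel {z. cmod (poly q z) \<le> t}"
  have A0: "A \<ge> 0" by (simp add: A_def)
  have inv: "(x ^ m) powr (1 / real m) = x" if "x \<ge> 0" for x :: real
    using that deg by (cases "x = 0") (auto simp: powr_realpow[symmetric] powr_powr)
  have "(A ^ m) powr (1 / real m) \<le> (pi ^ m * t\<^sup>2) powr (1 / real m)"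
    using polya_area_power[OF deg lead t] A0 by (intro powr_mono2) (auto simp: A_def)
  also have "\<dots> = pi * (t\<^sup>2) powr (1 / real m)" by (simp add: powr_mult inv)
  finally have "A \<le> pi * (t\<^sup>2) powr (1 / real m)" by (simp add: inv A0)
  moreover have "emeasure lborel {z. cmod (poly q z) \<le> t} = ennreal A"
    using emeasure_compact_finite[OF compact_poly_sublevel[of q t]] deg
    by (simp add: A_def emeasure_eq_ennreal_measure top.not_eq_extremum)
  ultimately show ?thesis by (simp add: ennreal_leI)
qed

text \<open>Every \<open>z\<close> is at distance at least |a - b|/2 from one of the two roots.
  Dividing \<open>q\<close> by that linear factor leaves a monic polynomial of degree
  \<open>m - 1\<close> that is at most 2t/|a - b| at \<open>z\<close>, so two sublevel sets of lower
  degree cover the original one.\<close>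

lemma area_sublevel_two_roots_le:
  fixes q :: "complex poly"
  assumes deg: "degree q = m" and lead: "lead_coeff q = 1"
    and roots: "poly q a = 0" "poly q b = 0" "a \<noteq> b" and t: "0 \<le> t"
  shows "emeasure lborel {z. cmod (poly q z) \<le> t}
    \<le> ennreal (2 * pi * ((2 * t / cmod (a - b))\<^sup>2) powr (1 / real (m - 1)))"
proof -
  let ?d = "cmod (a - b)" and ?u = "2 * t / cmod (a - b)"
  have d: "?d > 0" using roots by simp
  have fac: "\<exists>r. q = [:-c, 1:] * r \<and> degree r = m - 1 \<and> lead_coeff r = 1" if c: "poly q c = 0" for c
  proof -
    obtain r where r: "q = [:-c, 1:] * r" using c by (auto simp: poly_eq_0_iff_dvd)
    have "r \<noteq> 0" using r lead by auto
    then have "degree q = 1 + degree r" unfolding r by (subst degree_mult_eq) auto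
    moreover have "lead_coeff r = 1" using lead unfolding r lead_coeff_mult by simp
    ultimately show ?thesis using r deg by auto
  qed
  obtain r1 where r1: "q = [:-a, 1:] * r1" "degree r1 = m - 1" "lead_coeff r1 = 1" using fac roots by blast
  obtain r2 where r2: "q = [:-b, 1:] * r2" "degree r2 = m - 1" "lead_coeff r2 = 1" using fac roots by blast
  have "poly r1 b = 0" using roots r1(1) by simp
  \<comment> \<open>Otherwise \<open>r1\<close> would be the constant 1, yet it vanishes at
    \<open>b\<close>.\<close>
  then have m: "m - 1 \<ge> 1"
    using r1(2,3) by (cases "m - 1 = 0") (auto elim!: degree_eq_zeroE)
  have small: "cmod (poly r z) \<le> ?u"
    if r: "q = [:-c, 1:] * r" and z: "cmod (poly q z) \<le> t" "cmod (z - c) \<ge> ?d / 2" for c r z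
  proof -
    have "?d / 2 * cmod (poly r z) \<le> cmod (z - c) * cmod (poly r z)"
      using z(2) by (rule mult_right_mono) simp
    also have "\<dots> = cmod (poly q z)" by (simp add: r norm_mult[symmetric] left_diff_distrib)
    finally show ?thesis using z(1) d by (simp add: field_simps)
  qed
  have "{z. cmod (poly q z) \<le> t} \<subseteq> {z. cmod (poly r1 z) \<le> ?u} \<union> {z. cmod (poly r2 z) \<le> ?u}"
  proof
    fix z assume z: "z \<in> {z. cmod (poly q z) \<le> t}"
    have "?d \<le> cmod (z - a) + cmod (z - b)"
      using norm_triangle_ineq4[of "z - b" "z - a"] by simp
    then have "cmod (z - a) \<ge> ?d / 2 \<or> cmod (z - b) \<ge> ?d / 2" by linarith
    then show "z \<in> {z. cmod (poly r1 z) \<le> ?u} \<union> {z. cmod (poly r2 z) \<le> ?u}"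
      using small[OF r1(1)] small[OF r2(1)] z by auto
  qed
  then have "emeasure lborel {z. cmod (poly q z) \<le> t}
      \<le> emeasure lborel ({z. cmod (poly r1 z) \<le> ?u} \<union> {z. cmod (poly r2 z) \<le> ?u})"
    using compact_poly_sublevel r1(2) r2(2) m by (intro emeasure_mono) (auto simp: borel_compact)
  also have "\<dots> \<le> emeasure lborel {z. cmod (poly r1 z) \<le> ?u} + emeasure lborel {z. cmod (poly r2 z) \<le> ?u}"
    using compact_poly_sublevel r1(2) r2(2) m by (intro emeasure_subadditive) (auto simp: borel_compact)
  also have "\<dots> \<le> ennreal (pi * (?u\<^sup>2) powr (1 / real (m - 1))) + ennreal (pi * (?u\<^sup>2) powr (1 / real (m - 1)))"
    using polya_area[OF r1(2) m r1(3), of ?u] polya_area[OF r2(2) m r2(3), of ?u] t by (intro add_mono) auto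
  also have "\<dots> = ennreal (2 * pi * (?u\<^sup>2) powr (1 / real (m - 1)))"
    by (simp flip: ennreal_plus)
  finally show ?thesis .
qed

text \<open>With two distinct roots the area is O(t^(2/(m-1))), which for small \<open>t\<close> is
  below the extremal order t^(2/m). Equality is assumed only along levels tending to 0, which is
  what the equality case of the bathtub principle supplies.\<close>

lemma polya_area_equality:
  fixes q :: "complex poly"
  assumes deg: "degree q = m" "m \<ge> 1" and lead: "lead_coeff q = 1"
    and eq: "\<And>\<epsilon>. \<epsilon> > 0 \<Longrightarrow> \<exists>t. 0 < t \<and> t < \<epsilon> \<and>
      ennreal (pi * (t\<^sup>2) powr (1 / real m)) \<le> emeasure lborel {z. cmod (poly q z) \<le> t}"
  obtains a where "q = [:-a, 1:] ^ m"
proof -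
  have "\<not> constant (poly q)" using deg by (simp add: constant_degree)
  then obtain a where a: "poly q a = 0"
    using fundamental_theorem_of_algebra by blast
  have "b = a" if b: "poly q b = 0" for b
  proof (rule ccontr)
    assume "b \<noteq> a"
    \<comment> \<open>A linear polynomial has a single root; \<open>m \<ge> 2\<close> makes the
      exponent 2/(m - 1) meaningful.\<close>
    have m: "m \<ge> 2"
    proof (rule ccontr)
      assume "\<not> m \<ge> 2"
      then have "degree q = 1" using deg by simp
      then have "card {z. poly q z = 0} \<le> 1" using card_poly_roots_bound[of q] by force
      moreover have "finite {z. poly q z = 0}" using deg by (intro poly_roots_finite) auto
      ultimately show False using a b \<open>b \<noteq> a\<close> by (auto simp: card_le_Suc0_iff_eq)
    qed
    define d where "d = cmod (a - b)"
    have d: "d > 0" using \<open>b \<noteq> a\<close> by (simp add: d_def)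
    define \<beta> where "\<beta> = 2 / (real m - 1) - 2 / m"
    have \<beta>: "\<beta> > 0" using m by (simp add: \<beta>_def field_simps)
    \<comment> \<open>\<open>?C * t powr \<beta>\<close> is the ratio of the two-root bound to the
      extremal area; it tends to 0 with \<open>t\<close>.\<close>
    let ?C = "2 * (2 / d) powr (2 / (real m - 1))"
    have "((\<lambda>t. ?C * t powr \<beta>) \<longlongrightarrow> ?C * 0) (at_right 0)"
      using \<beta> by (intro tendsto_mult tendsto_const) real_asymp
    then have "\<forall>\<^sub>F t in at_right 0. ?C * t powr \<beta> < 1"
      by (rule order_tendstoD) simp
    then obtain \<epsilon> where \<epsilon>: "\<epsilon> > 0" "\<And>t. 0 < t \<Longrightarrow> t < \<epsilon> \<Longrightarrow> ?C * t powr \<beta> < 1"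
      unfolding eventually_at_right_field by auto
    obtain t where t: "0 < t" "t < \<epsilon>"
      and le: "ennreal (pi * (t\<^sup>2) powr (1 / real m)) \<le> emeasure lborel {z. cmod (poly q z) \<le> t}"
      using eq[OF \<epsilon>(1)] by blast
    have sq: "(x\<^sup>2) powr y = x powr (2 * y)" if "x > 0" for x y :: real
      using that powr_powr[of x 2 y] by simp
    note le
    also have "emeasure lborel {z. cmod (poly q z) \<le> t} \<le> ennreal (2 * pi * ((2 * t / d)\<^sup>2) powr (1 / real (m - 1)))"
      unfolding d_def using \<open>b \<noteq> a\<close> t by (intro area_sublevel_two_roots_le deg lead a b) auto
    finally have "pi * (t\<^sup>2) powr (1 / real m) \<le> 2 * pi * ((2 * t / d)\<^sup>2) powr (1 / real (m - 1))"
      by (simp add: ennreal_le_iff)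
    then have "t powr (2 / m) \<le> 2 * (2 / d * t) powr (2 / (real m - 1))"
      using t d m by (simp add: sq of_nat_diff)
    also have "\<dots> = ?C * t powr \<beta> * t powr (2 / m)"
    proof -
      have "t powr (2 / (real m - 1)) = t powr \<beta> * t powr (2 / m)"
        by (simp add: \<beta>_def flip: powr_add)
      then show ?thesis unfolding powr_mult by (simp only: mult.assoc)
    qed
    also have "\<dots> < 1 * t powr (2 / m)"
      by (rule mult_strict_right_mono[OF \<epsilon>(2)[OF t]]) (use t in simp)
    finally show False by (simp only: mult_1)
  qed
  then have "{z. poly q z = 0} = {a}" using a by blast
  from poly_eq_power_if_unique_root[OF this] show ?thesis
    unfolding lead unfolding deg(1) smult_1_left by (rule that)
qed

subsection \<open>Change of variables with multiplicity\<close>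

text \<open>The change of variables formula speaks of \<open>det (matrix _)\<close> on
  \<open>real^2\<close>, so the plane is identified with that space by mutually inverse,
  measure-preserving linear maps.\<close>

definition vec_to_complex :: "real^2 \<Rightarrow> complex" where
  "vec_to_complex v = Complex (v $ 1) (v $ 2)"

definition complex_to_vec :: "complex \<Rightarrow> real^2" where
  "complex_to_vec z = (\<chi> i. if i = 1 then Re z else Im z)"

lemma vec_to_complex_inverse [simp]: "complex_to_vec (vec_to_complex v) = v"
  using exhaust_2 by (auto simp: vec_to_complex_def complex_to_vec_def vec_eq_iff)

lemma complex_to_vec_inverse [simp]: "vec_to_complex (complex_to_vec z) = z"
  by (auto simp: vec_to_complex_def complex_to_vec_def complex_eq_iff)

lemma bounded_linear_vec_to_complex: "bounded_linear vec_to_complex"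
proof -
  have "linear vec_to_complex"
    by (intro linearI) (auto simp: vec_to_complex_def complex_eq_iff)
  then show ?thesis by (simp add: linear_conv_bounded_linear)
qed

lemma bounded_linear_complex_to_vec: "bounded_linear complex_to_vec"
proof -
  have "linear complex_to_vec"
    by (intro linearI) (auto simp: complex_to_vec_def vec_eq_iff)
  then show ?thesis by (simp add: linear_conv_bounded_linear)
qed

lemma measurable_vec_to_complex [measurable]: "vec_to_complex \<in> borel \<rightarrow>\<^sub>M borel"
  by (intro borel_measurable_continuous_onI linear_continuous_on bounded_linear_vec_to_complex)

text \<open>Boxes pull back to boxes with the same side lengths, and the measures of boxes determine
  \<open>lborel\<close>.\<close>

lemma distr_lborel_vec_to_complex: "distr lborel borel vec_to_complex = lborel"
proof (rule lborel_eqI[symmetric])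
  fix l u :: complex
  assume le: "\<And>b. b \<in> Basis \<Longrightarrow> l \<bullet> b \<le> u \<bullet> b"
  have "vec_to_complex -` box l u = box (complex_to_vec l) (complex_to_vec u)"
    by (auto simp: box_def Basis_complex_def Basis_vec_def cart_eq_inner_axis[symmetric] inner_axis
      vec_to_complex_def complex_to_vec_def forall_2)
  moreover have "\<And>b. b \<in> Basis \<Longrightarrow> complex_to_vec l \<bullet> b \<le> complex_to_vec u \<bullet> b"
    using le[of 1] le[of \<i>] by (auto simp: Basis_complex_def Basis_vec_def inner_axis complex_to_vec_def)
  moreover have "(\<Prod>b\<in>Basis. (complex_to_vec u - complex_to_vec l) \<bullet> b) = (\<Prod>b\<in>Basis. (u - l) \<bullet> b)"
  proof -
    have B: "(Basis :: (real^2) set) = {axis 1 1, axis 2 1}"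
      by (auto simp: Basis_vec_def) (metis exhaust_2)
    have "axis 1 (1::real) \<noteq> (axis 2 1 :: real^2)" by (simp add: axis_eq_axis)
    then show ?thesis
      by (simp add: B Basis_complex_def inner_axis complex_to_vec_def complex_eq_iff)
  qed
  ultimately show "emeasure (distr lborel borel vec_to_complex) (box l u) = (\<Prod>b\<in>Basis. (u - l) \<bullet> b)"
    by (simp add: emeasure_distr)
qed simp

lemma
  shows distr_lebesgue_vec_to_complex: "distr lebesgue lebesgue vec_to_complex = lebesgue"
    and measurable_lebesgue_vec_to_complex: "vec_to_complex \<in> lebesgue \<rightarrow>\<^sub>M lebesgue"
proof -
  have eq: "distr lebesgue lborel vec_to_complex = lborel"
    using distr_completion[of vec_to_complex lborel borel] distr_lborel_vec_to_complex
    by (simp cong: distr_cong)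
  show "vec_to_complex \<in> lebesgue \<rightarrow>\<^sub>M lebesgue"
    by (rule completion.measurable_completion2) (simp_all add: eq measurable_completion)
  show "distr lebesgue lebesgue vec_to_complex = lebesgue"
    using completion.completion_distr_eq[of vec_to_complex lborel lborel] eq
    by (simp add: measurable_completion)
qed

text \<open>Multiplication by \<open>d\<close> has the rows (Re d, -Im d) and (Im d, Re d). This is
  why |f'|^2 is the Jacobian of a holomorphic map.\<close>

lemma det_complex_derivative:
  "det (matrix (\<lambda>v. complex_to_vec (d * vec_to_complex v))) = (cmod d)\<^sup>2"
proof -
  have "matrix (\<lambda>v. complex_to_vec (d * vec_to_complex v)) $ i $ j =
     (if i = 1 then (if j = 1 then Re d else - Im d) else (if j = 1 then Im d else Re d))" for i j
    using exhaust_2[of i] exhaust_2[of j]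
    by (auto simp: matrix_def complex_to_vec_def vec_to_complex_def axis_def)
  then show ?thesis
    by (simp add: det_2 cmod_power2) (simp add: power2_eq_square)
qed

text \<open>The real area formula for injective differentiable maps, carried over from
  \<open>real^2\<close>, with Jacobian |f'|^2.\<close>

lemma nn_integral_deriv_square_inj:
  assumes S: "S \<in> sets lebesgue" and der: "\<And>z. z \<in> S \<Longrightarrow> (f has_field_derivative f' z) (at z within S)"
    and inj: "inj_on f S" and bdd: "bounded (f ` S)" and meas: "f' \<in> borel_measurable lebesgue"
  shows "f ` S \<in> sets lebesgue"
    and "(\<integral>\<^sup>+z. ennreal ((cmod (f' z))\<^sup>2) * indicator S z \<partial>lebesgue) = emeasure lebesgue (f ` S)"
proof -
  define T where "T = complex_to_vec ` S"
  have T_eq: "T = vec_to_complex -` S"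
    unfolding T_def by (auto simp: image_iff) (metis vec_to_complex_inverse)
  have Tm: "T \<in> sets lebesgue"
    using measurable_sets[OF measurable_lebesgue_vec_to_complex S] by (simp add: T_eq)
  let ?g = "complex_to_vec \<circ> f \<circ> vec_to_complex"
  let ?g' = "\<lambda>v w. complex_to_vec (f' (vec_to_complex v) * vec_to_complex w)"
  have STi: "vec_to_complex ` T = S"
    by (auto simp: T_def image_image)
  have gder: "(?g has_derivative ?g' v) (at v within T)" if "v \<in> T" for v
  proof -
    have 1: "(vec_to_complex has_derivative vec_to_complex) (at v within T)"
      by (rule bounded_linear_imp_has_derivative[OF bounded_linear_vec_to_complex])
    have 2: "(f has_derivative (\<lambda>w. f' (vec_to_complex v) * w)) (at (vec_to_complex v) within vec_to_complex ` T)"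
      using der[of "vec_to_complex v"] that STi by (simp add: T_eq has_field_derivative_def del: image_vimage_eq)
    have 3: "(complex_to_vec has_derivative complex_to_vec) (at ((f \<circ> vec_to_complex) v))"
      by (rule bounded_linear_imp_has_derivative[OF bounded_linear_complex_to_vec])
    show ?thesis
      using diff_chain_within[OF diff_chain_within[OF 1 2] has_derivative_at_withinI[OF 3]]
      by (simp add: o_def)
  qed
  have ginj: "inj_on ?g T"
    using inj unfolding T_def inj_on_def
    by (auto) (metis complex_to_vec_inverse)
  have gim: "?g ` T = complex_to_vec ` f ` S"
    by (simp only: image_comp[symmetric] STi)
  have gimv: "?g ` T = vec_to_complex -` (f ` S)"
    unfolding gim by (auto simp: image_iff) (metis vec_to_complex_inverse)
  have gbdd: "bounded (?g ` T)"
    unfolding gim using bounded_linear_image[OF bdd bounded_linear_complex_to_vec] .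
  have "?g ` T \<in> sets lebesgue"
    by (rule differentiable_image_in_sets_lebesgue[OF Tm])
      (use gder in \<open>auto simp: differentiable_on_def differentiable_def\<close>)
  \<comment> \<open>Boundedness makes the measure of the image finite, so that it can be the real
    value of a \<open>has_integral\<close> statement.\<close>
  then have gm: "?g ` T \<in> lmeasurable"
    using gbdd bounded_set_imp_lmeasurable by blast
  show fS: "f ` S \<in> sets lebesgue"
    by (rule differentiable_image_in_sets_lebesgue[OF S])
      (use der in \<open>auto simp: differentiable_on_def differentiable_def has_field_derivative_def\<close>)
  have hi: "((\<lambda>v. \<bar>det (matrix (?g' v))\<bar>) has_integral measure lebesgue (?g ` T)) T"
    using has_measure_differentiable_image[OF Tm gder ginj] gm by blast
  have hi': "((\<lambda>v. (cmod (f' (vec_to_complex v)))\<^sup>2 * indicator T v) has_integral measure lebesgue (?g ` T)) UNIV"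
  proof -
    have "(\<lambda>v. (cmod (f' (vec_to_complex v)))\<^sup>2 * indicator T v) =
      (\<lambda>v. if v \<in> T then (cmod (f' (vec_to_complex v)))\<^sup>2 else 0)"
      by auto
    then show ?thesis
      using hi unfolding det_complex_derivative by (simp add: has_integral_restrict_UNIV)
  qed
  have "(\<integral>\<^sup>+z. ennreal ((cmod (f' z))\<^sup>2) * indicator S z \<partial>lebesgue)
      = (\<integral>\<^sup>+z. ennreal ((cmod (f' z))\<^sup>2) * indicator S z \<partial>distr lebesgue lebesgue vec_to_complex)"
    by (simp add: distr_lebesgue_vec_to_complex)
  also have "\<dots> = (\<integral>\<^sup>+v. ennreal ((cmod (f' (vec_to_complex v)))\<^sup>2) * indicator S (vec_to_complex v) \<partial>lebesgue)"
    using meas S by (intro nn_integral_distr measurable_lebesgue_vec_to_complex) (simp add: distr_lebesgue_vec_to_complex)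
  also have "\<dots> = (\<integral>\<^sup>+v. ennreal ((cmod (f' (vec_to_complex v)))\<^sup>2 * indicator T v) \<partial>lebesgue)"
    by (intro nn_integral_cong) (auto simp: T_eq indicator_def)
  also have "\<dots> = ennreal (measure lebesgue (?g ` T))"
    using nn_integral_has_integral_lebesgue'[OF _ hi'] by (simp add: nn_integral_completion)
  also have "\<dots> = emeasure lebesgue (?g ` T)"
    using emeasure_eq_measure2[OF gm] by simp
  also have "\<dots> = emeasure (distr lebesgue lebesgue vec_to_complex) (f ` S)"
    unfolding gimv using emeasure_distr[OF measurable_lebesgue_vec_to_complex fS] by simp
  finally show "(\<integral>\<^sup>+z. ennreal ((cmod (f' z))\<^sup>2) * indicator S z \<partial>lebesgue) = emeasure lebesgue (f ` S)"
    by (simp add: distr_lebesgue_vec_to_complex)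
qed

text \<open>Each piece whose image contains \<open>w\<close> holds a preimage of \<open>w\<close>.
  Disjoint pieces hold different ones, and these are all roots of \<open>p - [:w:]\<close>, of which
  there are at most \<open>degree p\<close>.\<close>

lemma poly_vimage_sum_indicator_le:
  fixes p :: "complex poly" and D :: "nat \<Rightarrow> complex set"
  assumes "degree p \<ge> 1" and disj: "disjoint_family D"
  shows "(\<Sum>i. indicator (poly p ` (poly p -` K \<inter> D i)) w) \<le> of_nat (degree p) * (indicator K w :: ennreal)"
proof (cases "w \<in> K")
  case False
  then have "indicator (poly p ` (poly p -` K \<inter> D i)) w = (0::ennreal)" for i
    by (auto simp: indicator_def)
  then show ?thesis by simp
next
  case True
  let ?q = "p - [:w:]"
  have q0: "?q \<noteq> 0" and dq: "degree ?q \<le> degree p"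
    using assms(1) by (auto simp: degree_diff_le)
  have fin: "finite {z. poly ?q z = 0}"
    by (rule poly_roots_finite[OF q0])
  have card: "card {z. poly ?q z = 0} \<le> degree p"
    using card_poly_roots_bound[OF q0] dq by linarith
  have "(\<Sum>i<N. indicator (poly p ` (poly p -` K \<inter> D i)) w) \<le> (of_nat (degree p) :: ennreal)" for N
  proof -
    let ?J = "{i\<in>{..<N}. w \<in> poly p ` (poly p -` K \<inter> D i)}"
    have "\<forall>i\<in>?J. \<exists>z. z \<in> D i \<and> poly p z = w" by auto
    then obtain z where z: "\<And>i. i \<in> ?J \<Longrightarrow> z i \<in> D i \<and> poly p (z i) = w" by metis
    have "inj_on z ?J"
    proof (rule inj_onI)
      fix i j assume "i \<in> ?J" "j \<in> ?J" "z i = z j"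
      then have "D i \<inter> D j \<noteq> {}" using z[of i] z[of j] by auto
      then show "i = j" using disj by (auto simp: disjoint_family_on_def)
    qed
    moreover have "z ` ?J \<subseteq> {z. poly ?q z = 0}" using z by auto
    ultimately have "card ?J \<le> card {z. poly ?q z = 0}"
      using card_inj_on_le fin by blast
    then have "card ?J \<le> degree p" using card by simp
    moreover have "(\<Sum>i<N. indicator (poly p ` (poly p -` K \<inter> D i)) w) = (of_nat (card ?J) :: ennreal)"
      by (simp add: indicator_def sum.If_cases Int_def del: vimage_Int)
    ultimately show ?thesis by simp
  qed
  then have "(\<Sum>i. indicator (poly p ` (poly p -` K \<inter> D i)) w) \<le> (of_nat (degree p) :: ennreal)"
    by (intro suminf_le_const summableI)
  then show ?thesis using True by simp
qed

text \<open>Away from the finitely many critical points, \<open>p\<close> is locally injective.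
  Countably many balls of injectivity, made disjoint, cut the preimage into pieces on which the area
  formula is exact; the overlaps of their images are counted by the degree.\<close>

lemma nn_integral_poly_deriv_square_vimage_le:
  fixes p :: "complex poly"
  assumes deg: "degree p \<ge> 1" and K: "K \<in> sets borel"
  shows "(\<integral>\<^sup>+z. ennreal ((cmod (poly (pderiv p) z))\<^sup>2) * indicator (poly p -` K) z \<partial>lborel)
    \<le> of_nat (degree p) * emeasure lborel K"
proof -
  let ?h = "\<lambda>z. ennreal ((cmod (poly (pderiv p) z))\<^sup>2)"
  define E where "E = poly p -` K"
  define C where "C = {z. poly (pderiv p) z = 0}"
  have mp[measurable]: "poly q \<in> borel_measurable borel" for q :: "complex poly"
    by (intro borel_measurable_continuous_onI continuous_intros)
  have E: "E \<in> sets borel"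
    using measurable_sets[OF mp[of p] K] by (simp add: E_def)
  have "pderiv p \<noteq> 0" using deg by (simp add: pderiv_eq_0_iff)
  then have finC: "finite C" unfolding C_def by (rule poly_roots_finite)
  define \<B> where "\<B> = {B. \<exists>z r. B = ball z r \<and> inj_on (poly p) B}"
  have cover: "- C \<subseteq> \<Union>\<B>"
  proof
    fix z assume z: "z \<in> - C"
    have hol: "poly p holomorphic_on UNIV" by (intro holomorphic_intros)
    have "deriv (poly p) z = poly (pderiv p) z" by (intro DERIV_imp_deriv poly_DERIV)
    with z have "deriv (poly p) z \<noteq> 0" by (simp add: C_def)
    then obtain r where "r > 0" "inj_on (poly p) (ball z r)"
      using has_complex_derivative_locally_invertible[OF hol UNIV_I open_UNIV] by blast
    then show "z \<in> \<Union>\<B>" unfolding \<B>_def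
      by (intro UnionI[of "ball z r"]) auto
  qed
  obtain \<B>' where B': "\<B>' \<subseteq> \<B>" "countable \<B>'" "\<Union>\<B>' = \<Union>\<B>"
    by (rule Lindelof[of \<B>]) (auto simp: \<B>_def)
  \<comment> \<open>The countable cover must be nonempty for \<open>from_nat_into\<close> to
    enumerate it.\<close>
  have "infinite (- C)" using finC by (simp add: Compl_eq_Diff_UNIV infinite_UNIV_char_0)
  then have "- C \<noteq> {}" by force
  then have "\<B>' \<noteq> {}" using cover B'(3) by (metis Union_empty subset_empty)
  define B where "B = from_nat_into \<B>'"
  define D where "D = disjointed B"
  have rB: "range B = \<B>'" unfolding B_def using B'(2) \<open>\<B>' \<noteq> {}\<close> by (simp add: range_from_nat_into)
  have BB: "B i \<in> \<B>" for i using rB B'(1) by blast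
  have "open (B i)" for i using BB[of i] unfolding \<B>_def by auto
  then have Dm[measurable]: "D i \<in> sets borel" for i
    unfolding D_def using sets.range_disjointed_sets[of B borel] by (auto intro: borel_open)
  have Dsub: "D i \<subseteq> B i" for i unfolding D_def by (rule disjointed_subset)
  have disj: "disjoint_family D" unfolding D_def by (rule disjoint_family_disjointed)
  have UD: "- C \<subseteq> (\<Union>i. D i)"
    unfolding D_def UN_disjointed_eq using cover B'(3) rB by auto
  have piece: "poly p ` (E \<inter> D i) \<in> sets lebesgue"
    "(\<integral>\<^sup>+z. ?h z * indicator (E \<inter> D i) z \<partial>lebesgue) = emeasure lebesgue (poly p ` (E \<inter> D i))" for i
  proof -
    have inj: "inj_on (poly p) (E \<inter> D i)"
      using BB[of i] Dsub[of i] by (auto simp: \<B>_def intro: inj_on_subset)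
    obtain z r where "B i = ball z r" using BB[of i] by (auto simp: \<B>_def)
    \<comment> \<open>A piece lies in a ball, so its image lies in the compact image of the closed
      ball and is bounded.\<close>
    then have "poly p ` (E \<inter> D i) \<subseteq> poly p ` cball z r" using Dsub[of i] by auto
    moreover have "compact (poly p ` cball z r)"
      by (intro compact_continuous_image continuous_intros compact_cball)
    ultimately have bd: "bounded (poly p ` (E \<inter> D i))"
      using bounded_subset compact_imp_bounded by blast
    have S: "E \<inter> D i \<in> sets lebesgue" using E Dm[of i] by auto
    have md: "poly (pderiv p) \<in> borel_measurable lebesgue"
      by (simp add: measurable_completion)
    note * = nn_integral_deriv_square_inj[OF S _ inj bd md, OF poly_DERIV[THEN DERIV_subset, OF subset_UNIV]]
    show "poly p ` (E \<inter> D i) \<in> sets lebesgue"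
      "(\<integral>\<^sup>+z. ?h z * indicator (E \<inter> D i) z \<partial>lebesgue) = emeasure lebesgue (poly p ` (E \<inter> D i))"
      using * by auto
  qed
  have "AE z in lborel. z \<notin> C"
    using finC by (intro AE_not_in finite_imp_null_set_lborel)
  then have "AE z in lborel. ?h z * indicator E z = (\<Sum>i. ?h z * indicator (E \<inter> D i) z)"
  proof (rule AE_mp, intro AE_I2 impI)
    fix z assume "z \<notin> C"
    then obtain i where i: "z \<in> D i" using UD by blast
    then have "z \<notin> D j" if "j \<noteq> i" for j
      using disj that unfolding disjoint_family_on_def by blast
    then have "(\<Sum>j. ?h z * indicator (E \<inter> D j) z) = (\<Sum>j\<in>{i}. ?h z * indicator (E \<inter> D j) z)"
      by (intro suminf_finite) (auto simp: indicator_def)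
    then show "?h z * indicator E z = (\<Sum>j. ?h z * indicator (E \<inter> D j) z)"
      using i by (simp add: indicator_def)
  qed
  then have "(\<integral>\<^sup>+z. ?h z * indicator E z \<partial>lborel) = (\<integral>\<^sup>+z. (\<Sum>i. ?h z * indicator (E \<inter> D i) z) \<partial>lborel)"
    by (rule nn_integral_cong_AE)
  also have "\<dots> = (\<Sum>i. \<integral>\<^sup>+z. ?h z * indicator (E \<inter> D i) z \<partial>lborel)"
    using sets.Int[OF E Dm] by (intro nn_integral_suminf borel_measurable_times_ennreal borel_measurable_indicator) auto
  also have "\<dots> = (\<Sum>i. \<integral>\<^sup>+w. indicator (poly p ` (E \<inter> D i)) w \<partial>lebesgue)"
    \<comment> \<open>The integrals move to \<open>lebesgue\<close> because the images of the pieces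
      are only known to be Lebesgue measurable.\<close>
    by (intro suminf_cong trans[OF nn_integral_completion[symmetric] trans[OF piece(2) nn_integral_indicator[OF piece(1), symmetric]]])
  also have "\<dots> = (\<integral>\<^sup>+w. (\<Sum>i. indicator (poly p ` (E \<inter> D i)) w) \<partial>lebesgue)"
    using piece(1) by (intro nn_integral_suminf[symmetric]) auto
  also have "\<dots> \<le> (\<integral>\<^sup>+w. of_nat (degree p) * indicator K w \<partial>lebesgue)"
    unfolding E_def by (intro nn_integral_mono poly_vimage_sum_indicator_le deg disj)
  also have "\<dots> = of_nat (degree p) * emeasure lborel K"
    using K by (simp add: nn_integral_completion nn_integral_cmult)
  finally show ?thesis by (simp add: E_def)
qed

subsection \<open>The bathtub principle\<close>

lemma AE_eq_if_nn_integral_le: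
  fixes f g :: "'a \<Rightarrow> ennreal"
  assumes [measurable]: "f \<in> borel_measurable M" "g \<in> borel_measurable M"
    and le: "AE x in M. g x \<le> f x" and int: "integral\<^sup>N M f \<le> integral\<^sup>N M g" "integral\<^sup>N M g \<noteq> \<infinity>"
  shows "AE x in M. f x = g x"
proof -
  have "(\<integral>\<^sup>+x. f x - g x \<partial>M) = integral\<^sup>N M f - integral\<^sup>N M g"
    using assms by (intro nn_integral_diff) auto
  also have "\<dots> = 0"
    using int by (simp add: diff_eq_0_iff_ennreal less_top[symmetric] neq_top_trans)
  finally have "AE x in M. f x - g x = 0"
    by (subst (asm) nn_integral_0_iff_AE) auto
  then show ?thesis
    using le
  proof eventually_elim
    case (elim x)
    then have "f x \<le> g x" by (simp add: diff_eq_0_iff_ennreal)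
    with elim show ?case by simp
  qed
qed

text \<open>A nonempty open interval has positive measure. This yields individual levels at which an
  almost-everywhere identity may be used.\<close>

lemma ex_between_if_AE_lborel:
  assumes "AE s in lborel. P s" "(a::real) < b"
  shows "\<exists>s. a < s \<and> s < b \<and> P s"
proof (rule ccontr)
  assume no: "\<not> (\<exists>s. a < s \<and> s < b \<and> P s)"
  obtain N where N: "{s \<in> space lborel. \<not> P s} \<subseteq> N" "emeasure lborel N = 0" "N \<in> sets lborel"
    using AE_E[OF assms(1)] by blast
  have "{a<..<b} \<subseteq> N" using no N(1) by auto
  then have "emeasure lborel {a<..<b} \<le> 0" using N by (metis emeasure_mono)
  then show False using assms(2) by simp
qed

text \<open>\<open>S\<close> is the level at which the model area
  \<open>c * s powr (1 / real m)\<close> reaches \<open>A\<close>, so the integrand is nonnegative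
  up to \<open>S\<close> and vanishes there.\<close>

lemma nn_integral_bathtub:
  fixes A c :: real
  assumes m: "m \<ge> 1" and c: "c > 0" and A: "A > 0"
  defines "S \<equiv> (A / c) ^ m"
  shows "(\<integral>\<^sup>+s. ennreal (A - c * s powr (1 / real m)) * indicator {0..S} s \<partial>lborel)
    = ennreal (A * S / (m + 1))"
proof -
  have S: "S > 0" using A c by (simp add: S_def)
  have Sp: "S powr (1 / real m) = A / c"
    using A c m by (simp add: S_def powr_realpow[symmetric] powr_powr)
  have "((\<lambda>s. c * s powr (1 / real m)) has_integral c * (S powr (1 / real m + 1) / (1 / real m + 1))) {0..S}"
    using S m by (intro has_integral_mult_right has_integral_powr_from_0) (auto intro: less_le_trans[of _ 0])
  then have "((\<lambda>s. A - c * s powr (1 / real m)) has_integral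
      (A * S - c * (S powr (1 / real m + 1) / (1 / real m + 1)))) {0..S}"
    using has_integral_const_real[of A 0 S] S by (intro has_integral_diff) (auto simp: mult.commute)
  moreover have "c * (S powr (1 / real m + 1) / (1 / real m + 1)) = A * S * (m / (m + 1))"
  proof -
    have "S powr (1 / real m + 1) = A / c * S" using S by (simp add: powr_add Sp)
    moreover have "1 / real m + 1 = (real m + 1) / real m" using m by (simp add: field_simps)
    ultimately show ?thesis using c m by simp
  qed
  moreover have "A * S - A * S * (m / (m + 1)) = A * S / (m + 1)"
    by (simp add: field_simps)
  ultimately have hi: "((\<lambda>s. A - c * s powr (1 / real m)) has_integral (A * S / (m + 1))) {0..S}"
    by simp
  show ?thesis
  proof (rule nn_integral_has_integral_lebesgue'[OF _ hi])
    fix s assume s: "s \<in> {0..S}"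
    then have "s powr (1 / real m) \<le> S powr (1 / real m)" by (intro powr_mono2) auto
    then show "0 \<le> A - c * s powr (1 / real m)" using c by (simp add: Sp field_simps)
  qed
qed

text \<open>The part of \<open>E\<close> above level \<open>s\<close> has area at least
  \<open>A\<close> minus the sublevel area; integrating over \<open>s\<close> gives the lower bound.
  If the integral does not exceed it, this estimate is exact at almost every level: levels near 0
  show that sublevel sets there have maximal area, and levels above \<open>S\<close> show that
  almost no part of \<open>E\<close> lies above them.\<close>

lemma bathtub:
  fixes f :: "complex \<Rightarrow> real" and E :: "complex set"
  assumes f[measurable]: "f \<in> borel_measurable borel" and E[measurable]: "E \<in> sets borel"
    and m: "m \<ge> 1" and c: "c > 0"
    and V: "\<And>s. s \<ge> 0 \<Longrightarrow> emeasure lborel {z. f z \<le> s} \<le> ennreal (c * s powr (1 / real m))"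
    and A: "emeasure lborel E = ennreal A" "A > 0"
  defines "S \<equiv> (A / c) ^ m"
  shows bathtub_le: "ennreal (A * S / (m + 1)) \<le> (\<integral>\<^sup>+z. ennreal (f z) * indicator E z \<partial>lborel)"
    and bathtub_eq: "(\<integral>\<^sup>+z. ennreal (f z) * indicator E z \<partial>lborel) \<le> ennreal (A * S / (m + 1)) \<Longrightarrow>
      (\<forall>\<epsilon>>0. \<exists>s. 0 < s \<and> s < \<epsilon> \<and> ennreal (c * s powr (1 / real m)) \<le> emeasure lborel {z. f z \<le> s})
      \<and> {z\<in>E. S < f z} \<in> null_sets lborel"
proof -
  have S: "S > 0" using A c by (simp add: S_def)
  have Sp: "S powr (1 / real m) = A / c"
    using A c m by (simp add: S_def powr_realpow[symmetric] powr_powr)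
  define g where "g s = emeasure lborel {z\<in>E. s < f z} * indicator {0..} s" for s
  define h where "h s = ennreal (A - c * s powr (1 / real m)) * indicator {0..S} s" for s
  have layer: "(\<integral>\<^sup>+z. ennreal (f z) * indicator E z \<partial>lborel) = integral\<^sup>N lborel g"
    unfolding g_def by (rule nn_integral_layer_cake) measurable
  have inth: "integral\<^sup>N lborel h = ennreal (A * S / (m + 1))"
    unfolding h_def S_def using m c A by (intro nn_integral_bathtub)
  have split: "ennreal A \<le> emeasure lborel {z\<in>E. s < f z} + emeasure lborel {z. f z \<le> s}" for s
  proof -
    have "ennreal A \<le> emeasure lborel ({z\<in>E. s < f z} \<union> {z. f z \<le> s})"
      unfolding A(1)[symmetric] by (intro emeasure_mono) (auto simp: not_le)
    also have "\<dots> \<le> emeasure lborel {z\<in>E. s < f z} + emeasure lborel {z. f z \<le> s}"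
      by (intro emeasure_subadditive) measurable
    finally show ?thesis .
  qed
  have hg: "h s \<le> g s" for s
  proof (cases "0 \<le> s \<and> s \<le> S")
    case True
    have "ennreal A \<le> emeasure lborel {z\<in>E. s < f z} + ennreal (c * s powr (1 / real m))"
      using split[of s] V[of s] True by (meson add_left_mono order_trans)
    then have "ennreal A - ennreal (c * s powr (1 / real m)) \<le> emeasure lborel {z\<in>E. s < f z}"
      by (simp add: ennreal_minus_le_iff add.commute)
    then show ?thesis using True c by (simp add: h_def g_def ennreal_minus)
  qed (auto simp: h_def)
  show "ennreal (A * S / (m + 1)) \<le> (\<integral>\<^sup>+z. ennreal (f z) * indicator E z \<partial>lborel)"
    unfolding layer inth[symmetric] by (intro nn_integral_mono hg)
  assume le: "(\<integral>\<^sup>+z. ennreal (f z) * indicator E z \<partial>lborel) \<le> ennreal (A * S / (m + 1))"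
  have gm: "g \<in> borel_measurable lborel"
  proof -
    have "(\<lambda>s. (\<integral>\<^sup>+z. indicator {z\<in>E. s < f z} z \<partial>lborel) * indicator {0..} s) \<in> borel_measurable lborel"
      by measurable
    then show ?thesis unfolding g_def by simp
  qed
  have hm: "h \<in> borel_measurable lborel" unfolding h_def by measurable
  have AE: "AE s in lborel. g s = h s"
    using le hg by (intro AE_eq_if_nn_integral_le gm hm) (auto simp: layer inth)
  show "(\<forall>\<epsilon>>0. \<exists>s. 0 < s \<and> s < \<epsilon> \<and> ennreal (c * s powr (1 / real m)) \<le> emeasure lborel {z. f z \<le> s})
      \<and> {z\<in>E. S < f z} \<in> null_sets lborel"
  proof (intro conjI allI impI)
    fix \<epsilon> :: real assume "\<epsilon> > 0"
    \<comment> \<open>Staying below \<open>S\<close> keeps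
      \<open>A - c * s powr (1 / real m)\<close> nonnegative, so \<open>ennreal\<close> does not
      truncate it.\<close>
    then obtain s where s: "0 < s" "s < min \<epsilon> S" "g s = h s"
      using ex_between_if_AE_lborel[OF AE, of 0 "min \<epsilon> S"] S by auto
    have gs: "emeasure lborel {z\<in>E. s < f z} = ennreal (A - c * s powr (1 / real m))"
      using s by (simp add: g_def h_def)
    have "s powr (1 / real m) \<le> S powr (1 / real m)" using s by (intro powr_mono2) auto
    then have pos: "0 \<le> A - c * s powr (1 / real m)" using c by (simp add: Sp field_simps)
    have "ennreal (A - c * s powr (1 / real m)) + ennreal (c * s powr (1 / real m)) = ennreal A"
      using pos c by (simp flip: ennreal_plus)
    also have "\<dots> \<le> ennreal (A - c * s powr (1 / real m)) + emeasure lborel {z. f z \<le> s}"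
      using split[of s] by (simp add: gs)
    finally have "ennreal (c * s powr (1 / real m)) \<le> emeasure lborel {z. f z \<le> s}"
      by (simp add: ennreal_add_left_cancel_le)
    then show "\<exists>s. 0 < s \<and> s < \<epsilon> \<and> ennreal (c * s powr (1 / real m)) \<le> emeasure lborel {z. f z \<le> s}"
      using s by auto
  next
    \<comment> \<open>The identity need not hold at \<open>S\<close> itself. It is used at levels
      \<open>r k\<close> approaching \<open>S\<close> from above, where \<open>h\<close> is 0, and
      the superlevel set at \<open>S\<close> is the union of those at the
      \<open>r k\<close>.\<close>
    have "\<exists>s. S < s \<and> s < S + 1 / real (Suc k) \<and> g s = h s" for k
      by (rule ex_between_if_AE_lborel[OF AE]) simp
    then obtain r where r: "\<And>k. S < r k \<and> r k < S + 1 / real (Suc k) \<and> g (r k) = h (r k)" by metis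
    have null: "{z\<in>E. r k < f z} \<in> null_sets lborel" for k
    proof (rule null_setsI)
      show "emeasure lborel {z\<in>E. r k < f z} = 0"
      proof -
        have "r k \<notin> {0..S}" "r k \<in> {0..}" using r[of k] S by auto
        then show ?thesis using r[of k] by (simp add: g_def h_def)
      qed
    qed measurable
    have "{z\<in>E. S < f z} = (\<Union>k. {z\<in>E. r k < f z})"
    proof (intro set_eqI iffI)
      fix z assume z: "z \<in> {z\<in>E. S < f z}"
      then obtain k where "1 / real (Suc k) < f z - S"
        using nat_approx_posE[of "f z - S"] by auto
      then have "r k < f z" using r[of k] by linarith
      then show "z \<in> (\<Union>k. {z\<in>E. r k < f z})" using z by auto
    next
      fix z assume "z \<in> (\<Union>k. {z\<in>E. r k < f z})"
      then show "z \<in> {z\<in>E. S < f z}" using r by (auto intro: less_trans)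
    qed
    then show "{z\<in>E. S < f z} \<in> null_sets lborel" using null by (simp add: null_sets_UN)
  qed
qed

section \<open>The inequality and its equality case for Borel sets of finite area\<close>

text \<open>Normalising the derivative to the monic \<open>q\<close> makes Polya's inequality
  available with \<open>m = n - 1\<close>. The last part is the sublevel hypothesis of
  \<open>bathtub\<close> for |p'|^2.\<close>

lemma area_poly_deriv_sublevel_le:
  fixes p :: "complex poly"
  assumes lead: "lead_coeff p = 1" and n: "degree p = n" "n \<ge> 2"
  defines "q \<equiv> smult (1 / of_nat n) (pderiv p)"
  shows "degree q = n - 1" and "lead_coeff q = 1"
    and "s \<ge> 0 \<Longrightarrow> {z. (cmod (poly (pderiv p) z))\<^sup>2 \<le> s} = {z. cmod (poly q z) \<le> sqrt s / n}"
    and "s \<ge> 0 \<Longrightarrow> emeasure lborel {z. (cmod (poly (pderiv p) z))\<^sup>2 \<le> s}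
      \<le> ennreal (pi * (1 / (real n)\<^sup>2) powr (1 / real (n - 1)) * s powr (1 / real (n - 1)))"
proof -
  have dp': "degree (pderiv p) = n - 1" using n by (simp add: degree_pderiv)
  show dq: "degree q = n - 1" using n dp' by (simp add: q_def)
  have "coeff (pderiv p) (n - 1) = of_nat n" using n lead by (simp add: coeff_pderiv)
  then show lq: "lead_coeff q = 1" unfolding dq using n by (simp add: q_def)
  show eq: "{z. (cmod (poly (pderiv p) z))\<^sup>2 \<le> s} = {z. cmod (poly q z) \<le> sqrt s / n}" if "s \<ge> 0" for s
  proof -
    have "(cmod w)\<^sup>2 \<le> s \<longleftrightarrow> cmod w \<le> sqrt s" for w :: complex
      using real_sqrt_le_iff[of "(cmod w)\<^sup>2" s] by simp
    then show ?thesis using n by (simp add: q_def norm_mult norm_divide field_simps)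
  qed
  assume s: "s \<ge> 0"
  have "emeasure lborel {z. cmod (poly q z) \<le> sqrt s / n} \<le> ennreal (pi * ((sqrt s / n)\<^sup>2) powr (1 / real (n - 1)))"
    using n s by (intro polya_area dq lq) auto
  also have "(sqrt s / n)\<^sup>2 = 1 / (real n)\<^sup>2 * s" using s by (simp add: power_divide)
  finally show "emeasure lborel {z. (cmod (poly (pderiv p) z))\<^sup>2 \<le> s}
      \<le> ennreal (pi * (1 / (real n)\<^sup>2) powr (1 / real (n - 1)) * s powr (1 / real (n - 1)))"
    unfolding eq[OF s] powr_mult by (simp only: mult.assoc)
qed

text \<open>For p = (z - a)^n the first value is |p'|^2 on the circle about \<open>a\<close> that
  encloses area \<open>A\<close>. The second is the bathtub lower bound, to be compared with n
  Area(K).\<close>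

lemma bathtub_constant:
  fixes A :: real
  assumes "n \<ge> 2" "A > 0"
  defines "c \<equiv> pi * (1 / (real n)\<^sup>2) powr (1 / real (n - 1))"
  shows "(A / c) ^ (n - 1) = (real n)\<^sup>2 * (A / pi) ^ (n - 1)"
    and "A * (A / c) ^ (n - 1) / real (n - 1 + 1) = real n * (A ^ n / pi ^ (n - 1))"
proof -
  have root: "(x powr (1 / real m)) ^ m = x" if "x > 0" "m \<ge> 1" for x :: real and m :: nat
    using that by (simp add: powr_realpow[symmetric] powr_powr)
  have "((1 / (real n)\<^sup>2) powr (1 / real (n - 1))) ^ (n - 1) = 1 / (real n)\<^sup>2"
    using assms(1) by (intro root) auto
  then have "c ^ (n - 1) = pi ^ (n - 1) * (1 / (real n)\<^sup>2)"
    by (simp only: c_def power_mult_distrib)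
  then show *: "(A / c) ^ (n - 1) = (real n)\<^sup>2 * (A / pi) ^ (n - 1)"
    using assms(1) by (simp add: power_divide)
  have "real (n - 1 + 1) = real n" using assms(1) by simp
  moreover have "A ^ n = A * A ^ (n - 1)" using assms(1) by (cases n) auto
  ultimately show "A * (A / c) ^ (n - 1) / real (n - 1 + 1) = real n * (A ^ n / pi ^ (n - 1))"
    unfolding * unfolding power_divide using assms(1) by (simp add: power2_eq_square)
qed

text \<open>The bathtub principle needs the area of the preimage as a real number. Where |p'| >= 1
  the area is at most the integral of |p'|^2, and the rest lies in a sublevel set of finite
  area.\<close>

lemma area_poly_vimage_finite:
  fixes p :: "complex poly"
  assumes lead: "lead_coeff p = 1" and n: "degree p = n" "n \<ge> 1"
    and K: "K \<in> sets borel" "emeasure lborel K = ennreal k"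
  shows "poly p -` K \<in> sets borel" and "emeasure lborel (poly p -` K) < \<infinity>"
proof -
  define E where "E = poly p -` K"
  let ?f = "\<lambda>z. (cmod (poly (pderiv p) z))\<^sup>2"
  have mp[measurable]: "poly q \<in> borel_measurable borel" for q :: "complex poly"
    by (intro borel_measurable_continuous_onI continuous_intros)
  have E[measurable]: "E \<in> sets borel"
    using measurable_sets[OF mp[of p] K(1)] by (simp add: E_def)
  then show "poly p -` K \<in> sets borel" by (simp add: E_def)
  have int: "(\<integral>\<^sup>+z. ennreal (?f z) * indicator E z \<partial>lborel) < \<infinity>"
  proof -
    have "(\<integral>\<^sup>+z. ennreal (?f z) * indicator E z \<partial>lborel) \<le> of_nat n * ennreal k"
      using nn_integral_poly_deriv_square_vimage_le[of p K] n K by (simp add: E_def)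
    also have "\<dots> < \<infinity>" by (simp add: ennreal_mult_less_top of_nat_less_top)
    finally show ?thesis .
  qed
  have sub: "emeasure lborel {z\<in>E. 1 \<le> ?f z} \<le> (\<integral>\<^sup>+z. ennreal (?f z) * indicator E z \<partial>lborel)"
  proof -
    have "emeasure lborel {z\<in>E. 1 \<le> ?f z} = (\<integral>\<^sup>+z. indicator {z\<in>E. 1 \<le> ?f z} z \<partial>lborel)"
      by simp
    also have "\<dots> \<le> (\<integral>\<^sup>+z. ennreal (?f z) * indicator E z \<partial>lborel)"
      by (intro nn_integral_mono) (auto simp: indicator_def)
    finally show ?thesis .
  qed
  \<comment> \<open>The strict inequality makes this set empty for \<open>n = 1\<close>, where the
    derivative is 1.\<close>
  have V: "emeasure lborel {z. ?f z < 1} < \<infinity>"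
  proof (cases "n = 1")
    case True
    then have "degree (pderiv p) = 0" using n by (simp add: degree_pderiv)
    moreover have "coeff (pderiv p) 0 = 1" using n lead True by (simp add: coeff_pderiv)
    ultimately have "pderiv p = [:1:]" by (metis degree_eq_zeroE coeff_pCons_0)
    then show ?thesis by simp
  next
    case False
    then have "n \<ge> 2" using n by simp
    have "emeasure lborel {z. ?f z < 1} \<le> emeasure lborel {z. ?f z \<le> 1}"
      by (intro emeasure_mono) auto
    also have "\<dots> < \<infinity>"
      using area_poly_deriv_sublevel_le(4)[OF lead n(1) \<open>n \<ge> 2\<close>, of 1] by (simp add: le_less_trans)
    finally show ?thesis .
  qed
  have "emeasure lborel E \<le> emeasure lborel ({z\<in>E. 1 \<le> ?f z} \<union> {z. ?f z < 1})"
    by (intro emeasure_mono) auto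
  also have "\<dots> \<le> emeasure lborel {z\<in>E. 1 \<le> ?f z} + emeasure lborel {z. ?f z < 1}"
    by (intro emeasure_subadditive) measurable
  also have "\<dots> < \<infinity>" using sub int V by (simp add: le_less_trans)
  finally show "emeasure lborel (poly p -` K) < \<infinity>" by (simp add: E_def)
qed

lemma area_poly_vimage_power_le:
  fixes p :: "complex poly"
  assumes lead: "lead_coeff p = 1" and n: "degree p = n" "n \<ge> 1"
    and K: "K \<in> sets borel" "emeasure lborel K = ennreal k" "k \<ge> 0"
    and A: "emeasure lborel (poly p -` K) = ennreal A" "A \<ge> 0"
  shows "A ^ n \<le> pi ^ (n - 1) * k"
proof -
  let ?f = "\<lambda>z. (cmod (poly (pderiv p) z))\<^sup>2"
  have E: "poly p -` K \<in> sets borel" using area_poly_vimage_finite[OF lead n K(1,2)] by simp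
  have upper: "(\<integral>\<^sup>+z. ennreal (?f z) * indicator (poly p -` K) z \<partial>lborel) \<le> ennreal (n * k)"
    using nn_integral_poly_deriv_square_vimage_le[of p K] n K by (simp add: ennreal_mult ennreal_of_nat_eq_real_of_nat)
  consider "A = 0" | "n = 1" | "A > 0" "n \<ge> 2" using A n by linarith
  then show ?thesis
  proof cases
    case 1
    then show ?thesis using n K by (simp add: power_0_left)
  next
    case 2
    then have "degree (pderiv p) = 0" using n by (simp add: degree_pderiv)
    moreover have "coeff (pderiv p) 0 = 1" using n lead 2 by (simp add: coeff_pderiv)
    ultimately have "pderiv p = [:1:]" by (metis degree_eq_zeroE coeff_pCons_0)
    then show ?thesis using upper A K E 2 by (simp add: ennreal_le_iff)
  next
    case 3
    let ?c = "pi * (1 / (real n)\<^sup>2) powr (1 / real (n - 1))"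
    have "ennreal (A * (A / ?c) ^ (n - 1) / real (n - 1 + 1)) \<le> (\<integral>\<^sup>+z. ennreal (?f z) * indicator (poly p -` K) z \<partial>lborel)"
    proof (rule bathtub_le)
      show "?f \<in> borel_measurable borel"
        by (intro borel_measurable_continuous_onI continuous_intros)
      show "emeasure lborel {z. ?f z \<le> s} \<le> ennreal (?c * s powr (1 / real (n - 1)))" if "s \<ge> 0" for s
        by (rule area_poly_deriv_sublevel_le(4)[OF lead n(1) 3(2) that])
    qed (use 3 A E in auto)
    also note upper
    finally have "real n * (A ^ n / pi ^ (n - 1)) \<le> real n * k"
      unfolding bathtub_constant(2)[OF 3(2,1)] using K by (subst (asm) ennreal_le_iff) auto
    then show ?thesis using n by (simp add: field_simps)
  qed
qed

lemma power_poly_vimage_ball: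
  fixes p :: "complex poly"
  assumes p: "\<And>z. poly p z = (z - a) ^ n + c" and "n \<ge> 1" "r \<ge> 0"
  shows "poly p -` ball c (r ^ n) = ball a r"
proof -
  have "cmod (z - a) ^ n < r ^ n \<longleftrightarrow> cmod (z - a) < r" for z
    using assms(2,3) power_mono_iff[of r "cmod (z - a)" n] by (simp add: not_le[symmetric])
  then have "dist c (poly p z) < r ^ n \<longleftrightarrow> dist a z < r" for z
    unfolding p by (simp add: dist_norm norm_minus_commute[of a] norm_power)
  then show ?thesis by (simp add: set_eq_iff)
qed

text \<open>Equality passes to the bathtub bound. Its small levels force \<open>q\<close> to be a
  power of one linear factor; its top level puts almost all of the preimage in a disc of the same
  area, so the two agree up to a null set. Applying \<open>p\<close> gives the disc for
  \<open>K\<close>.\<close>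

lemma area_poly_vimage_power_eq:
  fixes p :: "complex poly"
  assumes lead: "lead_coeff p = 1" and n: "degree p = n" "n \<ge> 2"
    and K: "K \<in> sets borel" "emeasure lborel K = ennreal k" "k > 0"
    and A: "emeasure lborel (poly p -` K) = ennreal A" "A \<ge> 0" and eq: "A ^ n = pi ^ (n - 1) * k"
  obtains a c r where "r > 0" "\<And>z. poly p z = (z - a) ^ n + c"
    "pderiv p = smult (of_nat n) ([:-a, 1:] ^ (n - 1))" "negligible (sym_diff K (ball c r))"
proof -
  let ?f = "\<lambda>z. (cmod (poly (pderiv p) z))\<^sup>2"
  let ?c = "pi * (1 / (real n)\<^sup>2) powr (1 / real (n - 1))"
  define E where "E = poly p -` K"
  define q where "q = smult (1 / of_nat n) (pderiv p)"
  define R where "R = sqrt (A / pi)"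
  have n1: "n \<ge> 1" using n by simp
  have E: "E \<in> sets borel" using area_poly_vimage_finite[OF lead n(1) n1 K(1,2)] by (simp add: E_def)
  have A0: "A > 0" using A(2) eq K(3) n1 by (cases "A = 0") (auto simp: power_0_left)
  have R: "R > 0" "R\<^sup>2 = A / pi" using A0 by (auto simp: R_def)
  note q = area_poly_deriv_sublevel_le[OF lead n, folded q_def]
  have "(\<forall>\<epsilon>>0. \<exists>s. 0 < s \<and> s < \<epsilon> \<and> ennreal (?c * s powr (1 / real (n - 1))) \<le> emeasure lborel {z. ?f z \<le> s})
      \<and> {z\<in>E. (A / ?c) ^ (n - 1) < ?f z} \<in> null_sets lborel"
  proof (rule bathtub_eq)
    show "?f \<in> borel_measurable borel"
      by (intro borel_measurable_continuous_onI continuous_intros)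
    show "emeasure lborel {z. ?f z \<le> s} \<le> ennreal (?c * s powr (1 / real (n - 1)))" if "s \<ge> 0" for s
      by (rule q(4)[OF that])
    show "(\<integral>\<^sup>+z. ennreal (?f z) * indicator E z \<partial>lborel) \<le> ennreal (A * (A / ?c) ^ (n - 1) / real (n - 1 + 1))"
      unfolding bathtub_constant(2)[OF n(2) A0] E_def
      using nn_integral_poly_deriv_square_vimage_le[of p K] n K
      by (simp add: ennreal_mult ennreal_of_nat_eq_real_of_nat eq)
  qed (use n E A A0 in \<open>auto simp: E_def\<close>)
  then have small: "\<And>\<epsilon>. \<epsilon> > 0 \<Longrightarrow> \<exists>s. 0 < s \<and> s < \<epsilon> \<and>
        ennreal (?c * s powr (1 / real (n - 1))) \<le> emeasure lborel {z. ?f z \<le> s}"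
    and null: "{z\<in>E. (real n)\<^sup>2 * (A / pi) ^ (n - 1) < ?f z} \<in> null_sets lborel"
    unfolding bathtub_constant(1)[OF n(2) A0] by blast+
  \<comment> \<open>The level \<open>s\<close> of |p'|^2 corresponds to the level
    \<open>t = sqrt s / n\<close> of |q|; hence the bound \<open>(\<epsilon> * n)\<^sup>2\<close> on
    \<open>s\<close>.\<close>
  have extremal: "\<exists>t. 0 < t \<and> t < \<epsilon> \<and>
      ennreal (pi * (t\<^sup>2) powr (1 / real (n - 1))) \<le> emeasure lborel {z. cmod (poly q z) \<le> t}"
    if \<epsilon>: "\<epsilon> > 0" for \<epsilon>
  proof -
    obtain s where s: "0 < s" "s < (\<epsilon> * n)\<^sup>2"
      and le: "ennreal (?c * s powr (1 / real (n - 1))) \<le> emeasure lborel {z. ?f z \<le> s}"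
      using small[of "(\<epsilon> * n)\<^sup>2"] \<epsilon> n by auto
    have "sqrt s < \<epsilon> * n" using s \<epsilon> n by (intro real_less_lsqrt) auto
    then have "sqrt s / n < \<epsilon>" "0 < sqrt s / n" using n s by (auto simp: field_simps)
    moreover have "pi * ((sqrt s / n)\<^sup>2) powr (1 / real (n - 1)) = ?c * s powr (1 / real (n - 1))"
    proof -
      have "(sqrt s / n)\<^sup>2 = 1 / (real n)\<^sup>2 * s" using s by (simp add: power_divide)
      then show ?thesis by (simp only: powr_mult mult.assoc)
    qed
    moreover have "ennreal (?c * s powr (1 / real (n - 1))) \<le> emeasure lborel {z. cmod (poly q z) \<le> sqrt s / n}"
      using le q(3)[of s] s by simp
    ultimately show ?thesis
      by (intro exI[of _ "sqrt s / n"] conjI) (simp_all only:)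
  qed
  have "1 \<le> n - 1" using n by simp
  from polya_area_equality[OF q(1) this q(2) extremal]
  obtain a where a: "q = [:-a, 1:] ^ (n - 1)" by metis
  have p': "pderiv p = smult (of_nat n) ([:-a, 1:] ^ (n - 1))"
    unfolding a[symmetric] q_def using n by simp
  define c where "c = poly p a"
  have p: "poly p z = (z - a) ^ n + c" for z
    unfolding c_def by (rule monic_poly_eq_of_pderiv_eq[OF n1 p'])
  have "{z\<in>E. (real n)\<^sup>2 * (A / pi) ^ (n - 1) < ?f z} = E - cball a R"
  proof -
    have "(real n)\<^sup>2 * (A / pi) ^ (n - 1) < ?f z \<longleftrightarrow> R < cmod (z - a)" for z
    proof -
      have sq: "(x ^ k)\<^sup>2 = (x\<^sup>2) ^ k" for x :: real and k
        by (simp add: mult.commute flip: power_mult)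
      have "poly (pderiv p) z = of_nat n * (z - a) ^ (n - 1)" by (simp add: p')
      then have "?f z = (real n)\<^sup>2 * ((cmod (z - a))\<^sup>2) ^ (n - 1)"
        by (simp only: norm_mult norm_power power_mult_distrib norm_of_nat sq)
      moreover have "(R\<^sup>2) ^ (n - 1) < ((cmod (z - a))\<^sup>2) ^ (n - 1) \<longleftrightarrow> R < cmod (z - a)"
      proof -
        have "0 < 2 * (n - 1)" using n by simp
        then have "cmod (z - a) ^ (2 * (n - 1)) \<le> R ^ (2 * (n - 1)) \<longleftrightarrow> cmod (z - a) \<le> R"
          using R(1) by (intro power_mono_iff) auto
        then show ?thesis unfolding power_mult by linarith
      qed
      moreover have "0 < (real n)\<^sup>2" using n by simp
      ultimately show ?thesis unfolding R(2) by (simp only: mult_less_cancel_left_pos)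
    qed
    moreover have "z \<in> cball a R \<longleftrightarrow> \<not> R < cmod (z - a)" for z
      by (simp add: dist_norm norm_minus_commute not_less)
    ultimately show ?thesis by blast
  qed
  then have EB: "E - cball a R \<in> null_sets lborel" using null by simp
  \<comment> \<open>The disc has area \<open>A\<close>, as \<open>E\<close> does, and contains
    almost all of \<open>E\<close>; finiteness of \<open>A\<close> makes the remainder null.\<close>
  have BE: "cball a R - E \<in> null_sets lborel"
  proof -
    have cb: "emeasure lborel (cball a R) = ennreal A"
      using R by (simp add: emeasure_cball unit_ball_vol_2)
    have "emeasure lborel E = emeasure lborel (E - (E - cball a R))"
      by (rule emeasure_Diff_null_set[symmetric]) (use EB E in auto)
    also have "E - (E - cball a R) = cball a R \<inter> E" by auto
    finally have "emeasure lborel (cball a R \<inter> E) = ennreal A" using A by (simp add: E_def)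
    then have "emeasure lborel (cball a R - E) = 0"
      using emeasure_Diff[of lborel "cball a R \<inter> E" "cball a R"] E cb by (simp add: Diff_Int)
    then show ?thesis using E by (intro null_setsI) auto
  qed
  have negE: "negligible (sym_diff E (ball a R))"
  proof (rule negligible_subset)
    show "negligible ((E - cball a R) \<union> (cball a R - E) \<union> sphere a R)"
    proof (intro negligible_Un negligible_sphere)
      show "negligible (E - cball a R)" "negligible (cball a R - E)"
        unfolding negligible_iff_null_sets by (rule null_sets_completionI[OF EB] null_sets_completionI[OF BE])+
    qed
    have "sym_diff X B \<subseteq> (X - C) \<union> (C - X) \<union> (C - B)" if "B \<subseteq> C" for X B C :: "complex set"
      using that by blast
    from this[OF ball_subset_cball]
    show "sym_diff E (ball a R) \<subseteq> (E - cball a R) \<union> (cball a R - E) \<union> sphere a R"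
      unfolding cball_diff_eq_sphere[symmetric] .
  qed
  have "negligible (poly p ` sym_diff E (ball a R))"
  proof (rule negligible_differentiable_image_negligible[OF _ negE])
    show "poly p differentiable_on sym_diff E (ball a R)"
      by (intro holomorphic_on_imp_differentiable_on holomorphic_intros)
  qed simp
  \<comment> \<open>By the fundamental theorem of algebra \<open>w\<close> has a preimage, and
    membership transfers because \<open>E\<close> and \<open>ball a R\<close> are full preimages of
    \<open>K\<close> and the disc about \<open>c\<close>.\<close>
  moreover have "sym_diff K (ball c (R ^ n)) \<subseteq> poly p ` sym_diff E (ball a R)"
  proof
    fix w assume w: "w \<in> sym_diff K (ball c (R ^ n))"
    have "degree (p - [:w:]) = n"
      unfolding diff_conv_add_uminus using n by (subst degree_add_eq_left) auto
    then have "\<not> constant (poly (p - [:w:]))" using n by (simp add: constant_degree)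
    then obtain z where "poly (p - [:w:]) z = 0" by (metis fundamental_theorem_of_algebra)
    then have z: "poly p z = w" by simp
    have "z \<in> E \<longleftrightarrow> w \<in> K" using z by (simp add: E_def)
    moreover have "z \<in> ball a R \<longleftrightarrow> w \<in> ball c (R ^ n)"
      unfolding power_poly_vimage_ball[OF p n1 less_imp_le[OF R(1)], symmetric] vimage_eq z ..
    ultimately have "z \<in> sym_diff E (ball a R)" using w by (simp only: Un_iff Diff_iff)
    then show "w \<in> poly p ` sym_diff E (ball a R)" unfolding z[symmetric] by (rule imageI)
  qed
  ultimately have "negligible (sym_diff K (ball c (R ^ n)))" by (rule negligible_subset)
  then show ?thesis
    by (rule that[OF zero_less_power[OF R(1)] p p'])
qed

section \<open>Passage to Lebesgue measurable sets and the final statement\<close>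

lemma emeasure_eq_if_sym_diff_null:
  assumes "A \<in> sets M" "B \<in> sets M" "sym_diff A B \<in> null_sets M"
  shows "emeasure M A = emeasure M B"
proof (rule emeasure_eq_AE)
  show "AE x in M. x \<in> A \<longleftrightarrow> x \<in> B"
    using AE_not_in[OF assms(3)] by eventually_elim blast
qed (use assms in auto)

lemma sym_diff_vimage: "sym_diff (f -` A) (f -` B) = f -` sym_diff A B"
  by blast

lemma area_bound_finite:
  assumes "area K = ennreal k" "k \<ge> 0"
  shows "ennreal pi * ennreal_powr (area K / ennreal pi) (1 / real n) = ennreal (pi * (k / pi) powr (1 / real n))"
  using assms by (simp add: ennreal_powr_def divide_ennreal ennreal_mult)

text \<open>Connects the bound as stated with the form \<open>A ^ n \<le> pi ^ (n - 1) * k\<close>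
  proved for Borel sets.\<close>

lemma area_bound_power:
  assumes "n \<ge> 1" "k \<ge> 0"
  shows "(pi * (k / pi) powr (1 / real n)) ^ n = pi ^ (n - 1) * k"
proof -
  have root: "(x powr (1 / real n)) ^ n = x" if "x > 0" for x :: real
    using that assms(1) by (simp add: powr_realpow[symmetric] powr_powr)
  have "((k / pi) powr (1 / real n)) ^ n = k / pi"
    using assms root[of "k / pi"] by (cases "k = 0") (auto simp: power_0_left)
  moreover have "pi ^ n = pi * pi ^ (n - 1)" using assms(1) by (cases n) auto
  ultimately show ?thesis by (simp add: power_mult_distrib)
qed

text \<open>The preimage of the disc about \<open>c\<close> is the disc about \<open>a\<close> whose
  radius is the \<open>n\<close>-th root of \<open>r\<close>, and null changes of \<open>K\<close>
  have null preimages.\<close>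

lemma area_poly_vimage_ae_disc:
  assumes p: "\<And>z. poly p z = (z - a) ^ n + c" and n: "degree p = n" "n \<ge> 1"
    and K: "K \<in> sets lebesgue" "ae_disc K c r"
  shows "area (poly p -` K) = ennreal pi * ennreal_powr (area K / ennreal pi) (1 / real n)"
proof -
  define R where "R = root n r"
  have r: "r > 0" and null: "sym_diff K (ball c r) \<in> null_sets lebesgue"
    using K(2) by (auto simp: ae_disc_def)
  have R: "R > 0" "R ^ n = r" using r n by (auto simp: R_def)
  have "area K = emeasure lebesgue (ball c r)"
    unfolding area_def by (intro emeasure_eq_if_sym_diff_null null K) auto
  also have "\<dots> = ennreal (pi * r\<^sup>2)"
    using r by (simp add: emeasure_lborel_ball_complex)
  finally have aK: "area K = ennreal (pi * r\<^sup>2)" .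
  have "area (poly p -` K) = emeasure lebesgue (poly p -` ball c r)"
    unfolding area_def
  proof (rule emeasure_eq_if_sym_diff_null)
    show "sym_diff (poly p -` K) (poly p -` ball c r) \<in> null_sets lebesgue"
      unfolding sym_diff_vimage negligible_iff_null_sets[symmetric]
      using n null by (intro negligible_poly_vimage) (auto simp: negligible_iff_null_sets)
  qed (use n K in \<open>auto intro!: sets_lebesgue_poly_vimage\<close>)
  also have "poly p -` ball c r = ball a R"
    using power_poly_vimage_ball[OF p n(2), of R] R by simp
  also have "emeasure lebesgue (ball a R) = ennreal (pi * R\<^sup>2)"
    using R by (simp add: emeasure_lborel_ball_complex)
  also have "R\<^sup>2 = (r\<^sup>2) powr (1 / real n)"
  proof -
    have "(r\<^sup>2) powr (1 / real n) = ((R\<^sup>2) ^ n) powr (1 / real n)"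
      unfolding R(2)[symmetric] by (simp add: mult.commute flip: power_mult)
    also have "\<dots> = R\<^sup>2"
      using R(1) n(2) powr_realpow[of "R\<^sup>2" n] powr_powr[of "R\<^sup>2" "real n" "1 / real n"] by simp
    finally show ?thesis by simp
  qed
  finally show ?thesis
    using area_bound_finite[OF aK, of n] by simp
qed

text \<open>The equality criterion excludes \<open>n = 1\<close>, where equality always holds but
  there is no critical value, and null sets, which give equality without being discs. A set of
  infinite area is never a disc either.\<close>

theorem theorem2:
  fixes p :: "complex poly" and n :: nat and K :: "complex set"
  assumes "lead_coeff p = 1" and "degree p = n" and "n \<ge> 1"
    and "K \<in> sets lebesgue"
  shows "area (poly p -` K) \<le> ennreal pi * ennreal_powr (area K / ennreal pi) (1 / real n) \<and>
    (n \<ge> 2 \<and> 0 < area K \<and> area K < \<infinity> \<longrightarrow>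
      (area (poly p -` K) = ennreal pi * ennreal_powr (area K / ennreal pi) (1 / real n) \<longleftrightarrow>
        (\<exists>c r. ae_disc K c r \<and> critical_values p = {c})))"
proof (cases "area K = \<infinity>")
  case True
  then have "ennreal_powr (area K / ennreal pi) (1 / real n) = \<infinity>"
    by (simp add: ennreal_powr_def ennreal_top_divide)
  then show ?thesis using True by (simp add: ennreal_mult_top)
next
  case False
  then obtain k where k: "area K = ennreal k" "k \<ge> 0"
    by (cases "area K") auto
  \<comment> \<open>The Borel main part of \<open>K\<close> differs from it by a null set; the same
    holds for the preimages, so both areas are unchanged.\<close>
  define K' where "K' = main_part lborel K"
  have K': "K' \<in> sets borel" using main_part_sets[OF assms(4)] by (simp add: K'_def)
  have symK: "negligible (sym_diff K K')"
  proof -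
    have "sym_diff K K' \<subseteq> null_part lborel K"
      using main_part_null_part_Un[OF assms(4)] by (auto simp: K'_def)
    moreover have "negligible (null_part lborel K)"
      using null_part_null_sets[OF assms(4)] by (simp add: negligible_iff_null_sets)
    ultimately show ?thesis by (rule negligible_subset[rotated])
  qed
  have kK': "emeasure lborel K' = ennreal k"
    using assms(4) k(1) by (simp add: K'_def area_def)
  have sym_vimage: "sym_diff (poly p -` K) (poly p -` K') \<in> null_sets lebesgue"
    unfolding sym_diff_vimage negligible_iff_null_sets[symmetric]
    using assms symK by (intro negligible_poly_vimage) auto
  have E: "poly p -` K' \<in> sets borel" "emeasure lborel (poly p -` K') < \<infinity>"
    using area_poly_vimage_finite[OF assms(1-3) K' kK'] by auto
  then obtain A where A: "emeasure lborel (poly p -` K') = ennreal A" "A \<ge> 0"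
    by (cases "emeasure lborel (poly p -` K')") auto
  have aE: "area (poly p -` K) = ennreal A"
    using emeasure_eq_if_sym_diff_null[OF _ _ sym_vimage] E A assms
    by (simp add: area_def sets_lebesgue_poly_vimage)
  let ?B = "pi * (k / pi) powr (1 / real n)"
  note B = area_bound_finite[OF k, of n] and Bn = area_bound_power[OF assms(3) k(2)]
  have B0: "?B \<ge> 0" by simp
  have "A ^ n \<le> ?B ^ n"
    unfolding Bn by (rule area_poly_vimage_power_le[OF assms(1-3) K' kK' k(2) A])
  then have "A \<le> ?B" using power_mono_iff[OF A(2) B0] assms(3) by simp
  then have le: "area (poly p -` K) \<le> ennreal pi * ennreal_powr (area K / ennreal pi) (1 / real n)"
    unfolding aE B by (rule ennreal_leI)
  have "area (poly p -` K) = ennreal pi * ennreal_powr (area K / ennreal pi) (1 / real n) \<longleftrightarrow>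
      (\<exists>c r. ae_disc K c r \<and> critical_values p = {c})" if n: "n \<ge> 2" and pos: "0 < area K"
  proof
    assume "area (poly p -` K) = ennreal pi * ennreal_powr (area K / ennreal pi) (1 / real n)"
    then have "A = ?B" using A(2) B0 unfolding aE B by (simp only: ennreal_inj)
    then have "A ^ n = pi ^ (n - 1) * k" using Bn by simp
    moreover have "k > 0" using pos k by simp
    ultimately obtain a c r where r: "r > 0" and p: "\<And>z. poly p z = (z - a) ^ n + c"
      and p': "pderiv p = smult (of_nat n) ([:-a, 1:] ^ (n - 1))" and neg: "negligible (sym_diff K' (ball c r))"
      using area_poly_vimage_power_eq[OF assms(1,2) n K' kK' _ A] by metis
    have "poly (pderiv p) z = 0 \<longleftrightarrow> z = a" for z using n by (simp add: p')
    then have "critical_values p = {c}"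
      using assms(3) by (simp add: critical_values_def p power_0_left)
    moreover have "negligible (sym_diff K K' \<union> sym_diff K' (ball c r))"
      by (rule negligible_Un[OF symK neg])
    then have "negligible (sym_diff K (ball c r))"
      by (rule negligible_subset) blast
    then have "ae_disc K c r"
      using r by (simp add: ae_disc_def negligible_iff_null_sets)
    ultimately show "\<exists>c r. ae_disc K c r \<and> critical_values p = {c}" by blast
  next
    assume "\<exists>c r. ae_disc K c r \<and> critical_values p = {c}"
    then obtain c r where disc: "ae_disc K c r" and "critical_values p = {c}" by blast
    then have "{poly p z |z. poly (pderiv p) z = 0} = {c}" by (simp only: critical_values_def)
    then obtain a where "\<And>z. poly p z = (z - a) ^ n + c"
      using unique_critical_value_imp_power[OF assms(1,2) n] by metis
    then show "area (poly p -` K) = ennreal pi * ennreal_powr (area K / ennreal pi) (1 / real n)"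
      by (rule area_poly_vimage_ae_disc[OF _ assms(2-4) disc])
  qed
  then show ?thesis using le by blast
qed

end
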